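(* Let $K$ be an imaginary quadratic field of discriminant $\Delta\le -15$. Then the immediate tangency graph of $\widehat{\mathcal{S}}_K$ contains no loops (cycles).
   Context: Circles in $\widehat{\mathbb{C}}$ include lines. A $K$-Bianchi circle is $M(\widehat{\mathbb{R}})$, $M\in\mathrm{PSL}_2(\mathcal{O}_K)$ acting by Möbius transformations ($\mathcal{O}_K$ the ring of integers). An oriented circle is a circle with a direction of travel; its interior is the region to the left. $\widehat{\mathcal{S}}_K$ is the set of oriented circles whose underlying circle is a $K$-Bianchi circle. A collection of circles straddles an oriented circle $C$ if its union meets both the interior and exterior of $C$ nontrivially. Two oriented circles $C_1,C_2\in\widehat{\mathcal{S}}_K$ are immediately tangent if they are externally tangent (tangent with disjoint interiors) and the pair $\{C_1,C_2\}$ straddles no circle of $\widehat{\mathcal{S}}_K$. The immediate tangency graph of $\widehat{\mathcal{S}}_K$ has vertex set $\widehat{\mathcal{S}}_K$ and an edge between any two immediately tangent oriented circles. *)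

theory Defs
  imports "HOL-Analysis.Analysis" "HOL-Computational_Algebra.Polynomial"
    "Graph_Theory.Pair_Digraph"
begin

section \<open>Imaginary quadratic fields\<close>

definition complex_subfield :: "complex set \<Rightarrow> bool" where
  "complex_subfield K \<longleftrightarrow> 0 \<in> K \<and> 1 \<in> K \<and>
     (\<forall>x\<in>K. \<forall>y\<in>K. x - y \<in> K \<and> x * y \<in> K) \<and> (\<forall>x\<in>K. inverse x \<in> K)"

definition degree_over_rat :: "complex set \<Rightarrow> nat" where
  "degree_over_rat K = vector_space.dim (\<lambda>(q::rat) (z::complex). of_rat q * z) K"

text \<open>Fields come embedded in the complex numbers; both embeddings of an imaginary quadratic
  field have the same image.\<close>

definition imaginary_quadratic_field :: "complex set \<Rightarrow> bool" where
  "imaginary_quadratic_field K \<longleftrightarrow>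
     complex_subfield K \<and> degree_over_rat K = 2 \<and> \<not> K \<subseteq> \<real>"

definition ring_of_integers :: "complex set \<Rightarrow> complex set" where
  "ring_of_integers K = {x \<in> K. algebraic_int x}"

text \<open>The discriminant is the square of the determinant of \<open>(\<sigma>\<^sub>i \<omega>\<^sub>j)\<close> for an integral basis
  \<open>\<omega>\<^sub>1, \<omega>\<^sub>2\<close>, where the two embeddings of an imaginary quadratic field are the inclusion and
  complex conjugation.\<close>

definition has_discriminant :: "complex set \<Rightarrow> int \<Rightarrow> bool" where
  "has_discriminant K \<Delta> \<longleftrightarrow> (\<exists>\<omega>\<^sub>1 \<omega>\<^sub>2.
     bij_betw (\<lambda>(m::int, n::int). of_int m * \<omega>\<^sub>1 + of_int n * \<omega>\<^sub>2) UNIV (ring_of_integers K) \<and>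
     of_int \<Delta> = (\<omega>\<^sub>1 * cnj \<omega>\<^sub>2 - \<omega>\<^sub>2 * cnj \<omega>\<^sub>1)\<^sup>2)"

section \<open>The Riemann sphere and Bianchi circles\<close>

text \<open>\<open>None\<close> is the point at infinity, as in \<open>Alexandroff_compactification\<close>.\<close>

type_synonym riemann_sphere = "complex option"

definition extended_reals :: "riemann_sphere set" where
  "extended_reals = insert None (range (\<lambda>x::real. Some (complex_of_real x)))"

definition mobius_action :: "complex^2^2 \<Rightarrow> riemann_sphere \<Rightarrow> riemann_sphere" where
  "mobius_action M p = (case p of
       None \<Rightarrow> (if M$2$1 = 0 then None else Some (M$1$1 / M$2$1))
     | Some z \<Rightarrow> (if M$2$1 * z + M$2$2 = 0 then None
                 else Some (moebius (M$1$1) (M$1$2) (M$2$1) (M$2$2) z)))"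

definition SL2 :: "complex set \<Rightarrow> (complex^2^2) set" where
  "SL2 R = {M. (\<forall>i j. M$i$j \<in> R) \<and> det M = 1}"

text \<open>A class in \<open>PSL\<^sub>2\<close> is represented by either of its two lifts \<open>M\<close>, \<open>-M\<close> to \<open>SL\<^sub>2\<close>, which act
  in the same way.\<close>

definition is_Bianchi_circle :: "complex set \<Rightarrow> riemann_sphere set \<Rightarrow> bool" where
  "is_Bianchi_circle K S \<longleftrightarrow>
     (\<exists>M \<in> SL2 (ring_of_integers K). S = mobius_action M ` extended_reals)"

section \<open>Oriented circles\<close>

text \<open>\<open>CCW c r\<close> and \<open>CW c r\<close> are the circle of centre \<open>c\<close> and radius \<open>r\<close>, travelled counterclockwise
  and clockwise. \<open>Line u d\<close> is the line through \<open>\<i> * d * u\<close> travelled in the direction of the unit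
  vector \<open>u\<close>. Thus \<open>d\<close> is the signed distance of the line from the origin, and every oriented
  circle has exactly one description that satisfies \<open>is_oriented_circle\<close>.\<close>

datatype oriented_circle =
    CCW complex real
  | CW complex real
  | Line complex real

fun is_oriented_circle :: "oriented_circle \<Rightarrow> bool" where
  "is_oriented_circle (CCW c r) \<longleftrightarrow> r > 0"
| "is_oriented_circle (CW c r) \<longleftrightarrow> r > 0"
| "is_oriented_circle (Line u d) \<longleftrightarrow> cmod u = 1"

fun underlying_circle :: "oriented_circle \<Rightarrow> riemann_sphere set" where
  "underlying_circle (CCW c r) = Some ` sphere c r"
| "underlying_circle (CW c r) = Some ` sphere c r"
| "underlying_circle (Line u d) = insert None (Some ` {z. Im (z / u) = d})"

text \<open>The region to the left of the direction of travel. In the coordinate \<open>z / u\<close> the line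
  \<open>Line u d\<close> runs in the positive real direction, with larger imaginary parts to its left.\<close>

fun circle_interior :: "oriented_circle \<Rightarrow> riemann_sphere set" where
  "circle_interior (CCW c r) = Some ` ball c r"
| "circle_interior (CW c r) = insert None (Some ` (- cball c r))"
| "circle_interior (Line u d) = Some ` {z. Im (z / u) > d}"

definition circle_exterior :: "oriented_circle \<Rightarrow> riemann_sphere set" where
  "circle_exterior C = - (underlying_circle C \<union> circle_interior C)"

definition oriented_Bianchi_circles :: "complex set \<Rightarrow> oriented_circle set" where
  "oriented_Bianchi_circles K =
     {C. is_oriented_circle C \<and> is_Bianchi_circle K (underlying_circle C)}"

section \<open>Immediate tangency\<close>

definition straddles :: "oriented_circle set \<Rightarrow> oriented_circle \<Rightarrow> bool" where
  "straddles X C \<longleftrightarrow>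
     (\<Union>D\<in>X. underlying_circle D) \<inter> circle_interior C \<noteq> {} \<and>
     (\<Union>D\<in>X. underlying_circle D) \<inter> circle_exterior C \<noteq> {}"

text \<open>Two circles of the Riemann sphere are tangent if they meet in exactly one point; in
  particular, parallel lines are tangent at infinity.\<close>

definition externally_tangent :: "oriented_circle \<Rightarrow> oriented_circle \<Rightarrow> bool" where
  "externally_tangent C D \<longleftrightarrow>
     is_singleton (underlying_circle C \<inter> underlying_circle D) \<and>
     circle_interior C \<inter> circle_interior D = {}"

definition immediately_tangent ::
    "complex set \<Rightarrow> oriented_circle \<Rightarrow> oriented_circle \<Rightarrow> bool" where
  "immediately_tangent K C D \<longleftrightarrow>
     C \<in> oriented_Bianchi_circles K \<and> D \<in> oriented_Bianchi_circles K \<and>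
     externally_tangent C D \<and>
     \<not> (\<exists>B \<in> oriented_Bianchi_circles K. straddles {C, D} B)"

text \<open>The relation is symmetric, so the undirected graph is represented by the symmetric digraph
  with both arcs for each edge.\<close>

definition immediate_tangency_graph :: "complex set \<Rightarrow> oriented_circle pair_pre_digraph" where
  "immediate_tangency_graph K =
     \<lparr> pverts = oriented_Bianchi_circles K,
       parcs = {(C, D). immediately_tangent K C D} \<rparr>"

text \<open>The cycles of an undirected graph are the directed cycles of its symmetric digraph, except
  that the digraph also has a directed cycle of length two that runs back and forth along each
  edge.\<close>

definition has_undirected_cycle :: "'a pair_pre_digraph \<Rightarrow> bool" where
  "has_undirected_cycle G \<longleftrightarrow> (\<exists>p. pre_digraph.cycle (with_proj G) p \<and> length p \<noteq> 2)"

end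

theory Submission
  imports Defs
begin

text \<open>Oriented circles are encoded by Hermitian forms of determinant \<open>-1\<close> on \<open>\<complex>\<^sup>2\<close>, the circle being
  the zero set and the interior the negative set, so that Moebius maps act by linear substitution and
  the oriented Bianchi circles form a single orbit. The immediate neighbours of the real line are the
  line \<open>Im z = -\<surd>\<bar>\<Delta>\<bar>/2\<close> and its images under the modular group. The rest is ping-pong. An element of
  the modular group that moves \<open>\<infinity>\<close> maps the complement of the open unit discs around the integers into
  the union of the closed discs, and a half-turn exchanges the real line with its lower neighbour and
  the integers with the next row of the lattice of integers of the field. For \<open>\<Delta> \<le> -15\<close> the unit discs
  around these two rows do not overlap, so a path that leaves the real line other than through the
  lower neighbour and never backtracks stays in the discs around the integers, and can never reach the
  lower neighbour. A cycle would provide such a path.\<close>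

section \<open>Rings of integers of imaginary quadratic fields\<close>

text \<open>The bound on the discriminant acts through an integrality step. With \<open>h\<close>
  half the square root of \<open>-\<Delta>\<close>, the norms of the numbers
  \<open>\<omega> + n\<close> are integers and at least \<open>h^2 \<ge> 15/4\<close>, hence at
  least 4; so the two rows of discs stay apart even at discriminant -15. At -11 the next row
  contains a number of norm 3 and the discs overlap. Modular elements fixing infinity are
  translations up to sign and preserve the lower neighbour, so every other neighbour of the real
  line comes from an element that moves infinity. The half-turn re-roots a path at its second
  circle: the circle just left becomes the lower neighbour, and not backtracking is exactly what the
  induction needs to continue. Homogeneous coordinates make infinity an ordinary point in all
  estimates.\<close>

text \<open>The library has no closure of algebraic integers under products. In a quadratic field closure
  under squares is enough: by the definition of the discriminant the integers form a group, so
  \<open>\<omega> \<cdot> cnj \<omega> = (\<omega> + cnj \<omega>) \<cdot> \<omega> - \<omega>\<^sup>2\<close> is an integer, and \<open>\<int> + \<int>\<omega>\<close> is closed under products.\<close>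

lemma poly_even_odd_split:
  fixes p :: "complex poly"
  assumes "\<forall>i. coeff p i \<in> \<int>"
  shows "\<exists>e d. p = pcompose e [:0, 0, 1:] + [:0, 1:] * pcompose d [:0, 0, 1:] \<and>
    (\<forall>i. coeff e i \<in> \<int>) \<and> (\<forall>i. coeff d i \<in> \<int>)"
  using assms
proof (induction p)
  case 0
  show ?case by (rule exI[of _ 0], rule exI[of _ 0]) auto
next
  case (pCons a p)
  have "coeff p i \<in> \<int>" for i
    using pCons.prems[rule_format, of "Suc i"] by simp
  then obtain e d where "p = pcompose e [:0, 0, 1:] + [:0, 1:] * pcompose d [:0, 0, 1:]"
      "\<forall>i. coeff e i \<in> \<int>" "\<forall>i. coeff d i \<in> \<int>"
    using pCons.IH by blast
  moreover have "a \<in> \<int>" using pCons.prems[rule_format, of 0] by simp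
  \<comment> \<open>Multiplying by the variable exchanges the parts:
    \<open>a + x (e(x^2) + x d(x^2)) = (a + x^2 d(x^2)) + x e(x^2)\<close>.\<close>
  ultimately show ?case
    by (intro exI[of _ "pCons a d"] exI[of _ e])
      (auto simp: pcompose_pCons coeff_pCons algebra_simps split: nat.splits)
qed

text \<open>Graeffe's root squaring: \<open>p(y) p(-y) = r(y^2)\<close> for
  \<open>r(t) = e(t)^2 - t d(t)^2\<close>, which vanishes at \<open>x^2\<close> and is monic up to
  the sign \<open>(-1) ^ degree p\<close>.\<close>

lemma algebraic_int_square:
  fixes x :: complex
  assumes "algebraic_int x"
  shows "algebraic_int (x\<^sup>2)"
proof -
  from assms obtain p where p: "lead_coeff p = 1" "\<forall>i. coeff p i \<in> \<int>" "poly p x = 0"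
    by (auto simp: algebraic_int.simps)
  obtain e d where ed: "p = pcompose e [:0, 0, 1:] + [:0, 1:] * pcompose d [:0, 0, 1:]"
    "\<forall>i. coeff e i \<in> \<int>" "\<forall>i. coeff d i \<in> \<int>"
    using poly_even_odd_split[OF p(2)] by blast
  define r where "r = e * e - [:0, 1:] * d * d"
  have "poly (pcompose r [:0, 0, 1:]) y = poly (p * pcompose p [:0, -1:]) y" for y
    by (simp add: ed(1) r_def poly_pcompose algebra_simps)
  then have "pcompose r [:0, 0, 1:] = p * pcompose p [:0, -1:]"
    by (simp add: fun_eq_iff flip: poly_eq_poly_eq_iff)
  then have "lead_coeff (pcompose r [:0, 0, 1:]) = lead_coeff p * lead_coeff (pcompose p [:0, -1:])"
    by (simp add: lead_coeff_mult)
  then have "lead_coeff r = (-1) ^ degree p"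
    by (subst (asm) lead_coeff_comp, simp, subst (asm) lead_coeff_comp) (use p in auto)
  moreover have "coeff r i \<in> \<int>" for i
    using ed by (auto simp: r_def coeff_mult coeff_pCons split: nat.splits intro!: Ints_diff Ints_sum Ints_mult)
  moreover have "poly r (x\<^sup>2) = poly p x * poly (pcompose p [:0, -1:]) x"
    by (simp add: ed r_def poly_pcompose algebra_simps power2_eq_square)
  ultimately show ?thesis
    using p by (intro algebraic_int.intros[of "smult ((-1) ^ degree p) r"])
      (auto simp flip: power_mult_distrib)
qed

lemma quadratic_field_rational_relation:
  assumes K: "degree_over_rat K = 2" and X: "x \<in> K" "y \<in> K" "z \<in> K"
  shows "\<exists>a b c :: rat. (a, b, c) \<noteq> (0, 0, 0) \<and> of_rat a * x + of_rat b * y + of_rat c * z = 0"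
proof -
  interpret vs: vector_space "\<lambda>(q::rat) (z::complex). of_rat q * z"
    by unfold_locales (auto simp: algebra_simps of_rat_add of_rat_mult)
  obtain B where B: "B \<subseteq> K" "vs.independent B" "K \<subseteq> vs.span B" "card B = 2"
    using vs.basis_exists[of K] K by (metis degree_over_rat_def)
  have fB: "finite B" using B(4) by (simp add: card_ge_0_finite)
  \<comment> \<open>Independence is a property of sets, so coinciding elements are treated
    apart.\<close>
  consider "x = y" | "x = z" | "y = z" | "card {x, y, z} = 3" by fastforce
  then show ?thesis
  proof cases
    case 4
    then have d: "x \<noteq> y" "x \<noteq> z" "y \<noteq> z" by (auto simp: card_insert_if split: if_splits)
    have "vs.dependent {x, y, z}"
      using vs.independent_span_bound[OF fB, of "{x, y, z}"] X B 4 by fastforce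
    then obtain u where "\<exists>v\<in>{x, y, z}. u v \<noteq> 0" "(\<Sum>v\<in>{x, y, z}. of_rat (u v) * v) = 0"
      by (auto simp: vs.dependent_finite)
    then show ?thesis using d
      by (intro exI[of _ "u x"] exI[of _ "u y"] exI[of _ "u z"]) (auto simp: add.assoc)
  next
    case 1
    then show ?thesis
      by (intro exI[of _ 1] exI[of _ "-1"] exI[of _ 0]) (simp add: of_rat_minus)
  next
    case 2
    then show ?thesis
      by (intro exI[of _ 1] exI[of _ 0] exI[of _ "-1"]) (simp add: of_rat_minus)
  next
    case 3
    then show ?thesis
      by (intro exI[of _ 0] exI[of _ 1] exI[of _ "-1"]) (simp add: of_rat_minus)
  qed
qed

text \<open>In a rational relation between 1, \<open>x\<close> and a non-real element of
  \<open>K\<close>, the imaginary part kills the coefficient of the latter.\<close>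

lemma imaginary_quadratic_real_is_rational:
  assumes K: "imaginary_quadratic_field K" and x: "x \<in> K" "Im x = 0"
  shows "x \<in> \<rat>"
proof -
  from K obtain k where k: "k \<in> K" "Im k \<noteq> 0"
    unfolding imaginary_quadratic_field_def by (meson complex_is_Real_iff subsetI)
  from K have "1 \<in> K" "degree_over_rat K = 2"
    by (auto simp: imaginary_quadratic_field_def complex_subfield_def)
  then obtain a b c where abc: "(a, b, c) \<noteq> (0, 0, 0)"
      "of_rat a * 1 + of_rat b * x + of_rat c * k = 0"
    using quadratic_field_rational_relation[of K 1 x k] x k by blast
  have ofr: "of_rat q = complex_of_real (of_rat q)" for q :: rat
    by (cases q) (simp add: of_rat_rat)
  have "Im (of_rat a * 1 + of_rat b * x + of_rat c * k) = of_rat c * Im k"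
    using x unfolding ofr by simp
  with abc k have c: "c = 0" by simp
  with abc have b: "b \<noteq> 0" by auto
  have "x = of_rat (- a / b)"
    using abc(2) b c by (simp add: of_rat_divide of_rat_minus field_simps eq_neg_iff_add_eq_0)
  then show ?thesis by simp
qed

text \<open>For non-real \<open>x\<close>, the imaginary part of a rational relation between 1,
  \<open>x\<close> and \<open>x^2\<close> becomes \<open>b + 2 c Re x = 0\<close> after division by
  \<open>Im x\<close>.\<close>

lemma imaginary_quadratic_trace_rational:
  assumes K: "imaginary_quadratic_field K" and x: "x \<in> K"
  shows "x + cnj x \<in> \<rat>"
proof (cases "Im x = 0")
  case True
  then have "cnj x = x" by (simp add: complex_eq_iff)
  then show ?thesis using imaginary_quadratic_real_is_rational[OF K x True] by simp
next
  case False
  from K have "1 \<in> K" "degree_over_rat K = 2" "x * x \<in> K"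
    using x by (auto simp: imaginary_quadratic_field_def complex_subfield_def)
  then obtain a b c where abc: "(a, b, c) \<noteq> (0, 0, 0)"
      "of_rat a * 1 + of_rat b * x + of_rat c * (x * x) = 0"
    using quadratic_field_rational_relation[of K 1 x "x * x"] x by blast
  have ofr: "of_rat q = complex_of_real (of_rat q)" for q :: rat
    by (cases q) (simp add: of_rat_rat)
  have "Im (of_rat a * 1 + of_rat b * x + of_rat c * (x * x)) =
      Im x * (of_rat b + of_rat c * (2 * Re x))"
    unfolding ofr by (simp add: algebra_simps)
  with abc False have *: "of_rat b + of_rat c * (2 * Re x) = 0" by simp
  have "c \<noteq> 0"
  proof
    assume c: "c = 0"
    with * have "b = 0" by simp
    with c abc show False by simp
  qed
  then have "2 * Re x = of_rat (- b / c)"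
    using * by (simp add: of_rat_divide of_rat_minus field_simps eq_neg_iff_add_eq_0)
  then have "x + cnj x = of_rat (- b / c)"
    unfolding complex_add_cnj by (subst ofr) simp
  then show ?thesis by simp
qed


text \<open>The last condition is where \<open>\<Delta> \<le> -15\<close> enters: unit discs around lattice points on the real
  line and on the next horizontal row of lattice points do not overlap.\<close>

locale quadratic_order =
  fixes R :: "complex set" and \<omega> :: complex and h :: real
  assumes one_closed: "1 \<in> R"
    and diff_closed: "x \<in> R \<Longrightarrow> y \<in> R \<Longrightarrow> x - y \<in> R"
    and mult_closed: "x \<in> R \<Longrightarrow> y \<in> R \<Longrightarrow> x * y \<in> R"
    and cnj_closed: "x \<in> R \<Longrightarrow> cnj x \<in> R"
    and omega_closed: "\<omega> \<in> R"
    and Im_omega: "Im \<omega> = h"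
    and h_pos: "h > 0"
    and h_large: "h\<^sup>2 \<ge> 15 / 4"
    and Im_multiple: "x \<in> R \<Longrightarrow> \<exists>k::int. Im x = h * of_int k"
    and real_closed: "x \<in> R \<Longrightarrow> Im x = 0 \<Longrightarrow> x \<in> \<int>"
    and omega_far: "2 \<le> cmod (\<omega> + of_int n)"

lemma quadratic_order_ring_of_integers:
  assumes K: "imaginary_quadratic_field K" and D: "has_discriminant K \<Delta>" and Dle: "\<Delta> \<le> -15"
  shows "\<exists>\<omega> h. quadratic_order (ring_of_integers K) \<omega> h"
proof -
  define R where "R = ring_of_integers K"
  obtain w1 w2 where
    bij: "bij_betw (\<lambda>(m::int, n::int). of_int m * w1 + of_int n * w2) UNIV R"
    and disc: "of_int \<Delta> = (w1 * cnj w2 - w2 * cnj w1)\<^sup>2"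
    using D unfolding has_discriminant_def R_def by blast
  have R_iff: "x \<in> R \<longleftrightarrow> (\<exists>m n::int. x = of_int m * w1 + of_int n * w2)" for x
    using bij_betw_imp_surj_on[OF bij] by fastforce
  have K_ring: "0 \<in> K" "1 \<in> K" "\<And>x y. x \<in> K \<Longrightarrow> y \<in> K \<Longrightarrow> x - y \<in> K"
      "\<And>x y. x \<in> K \<Longrightarrow> y \<in> K \<Longrightarrow> x * y \<in> K"
    using K by (auto simp: imaginary_quadratic_field_def complex_subfield_def)
  have one: "1 \<in> R" by (simp add: R_def ring_of_integers_def K_ring)
  have lin: "of_int m * x + of_int n * y \<in> R" if xy: "x \<in> R" "y \<in> R" for m n :: int and x y
  proof -
    obtain a b c d :: int where "x = of_int a * w1 + of_int b * w2" "y = of_int c * w1 + of_int d * w2"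
      using xy R_iff by meson
    then show ?thesis unfolding R_iff
      by (intro exI[of _ "m * a + n * c"] exI[of _ "m * b + n * d"]) (simp add: algebra_simps)
  qed
  have diff: "x - y \<in> R" if "x \<in> R" "y \<in> R" for x y
    using lin[OF that, of 1 "-1"] by simp
  have real: "x \<in> \<int>" if "x \<in> R" "Im x = 0" for x
    using that imaginary_quadratic_real_is_rational[OF K, of x] rational_algebraic_int_is_int[of x]
    by (auto simp: R_def ring_of_integers_def)
  obtain m n :: int where mn: "1 = of_int m * w1 + of_int n * w2"
    using one R_iff by blast
  \<comment> \<open>1 is a primitive vector of the lattice: otherwise \<open>1 / g\<close> would be
    a real integer of the field, hence a rational integer.\<close>
  have "gcd m n = 1"
  proof -
    define g where "g = gcd m n"
    obtain m' n' where g: "m = g * m'" "n = g * n'"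
      unfolding g_def by (metis dvdE gcd_dvd1 gcd_dvd2)
    have "1 = of_int g * (of_int m' * w1 + of_int n' * w2)"
      using mn by (simp add: g algebra_simps)
    moreover from this have "of_int m' * w1 + of_int n' * w2 = complex_of_real (inverse (of_int g))"
      by (metis inverse_unique of_real_inverse of_real_of_int_eq)
    then have "Im (of_int m' * w1 + of_int n' * w2) = 0" by (metis Im_complex_of_real)
    then have "of_int m' * w1 + of_int n' * w2 \<in> \<int>"
      using R_iff by (intro real) blast+
    ultimately obtain j :: int where "(1::complex) = of_int g * of_int j"
      by (metis Ints_cases)
    then have "1 = g * j" by (metis of_int_eq_1_iff of_int_mult)
    then have "g dvd 1" by (metis dvd_triv_left)
    then show ?thesis by (simp add: g_def)
  qed
  then obtain u v where uv: "u * m + v * n = 1" using bezout_int by metis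
  \<comment> \<open>The Bezout coefficients complete \<open>(m, n)\<close> to a matrix of
    determinant 1, so \<open>1, om0\<close> is again an integral basis.\<close>
  define om0 where "om0 = - of_int v * w1 + of_int u * w2"
  define om where "om = (if Im om0 > 0 then om0 else - om0)"
  have "om0 \<in> R" unfolding R_iff om0_def by (intro exI[of _ "-v"] exI[of _ u]) simp
  then have omR: "om \<in> R" using lin[of om0 om0 "-1" 0] by (auto simp: om_def)
  have uvc: "of_int u * of_int m + of_int v * of_int n = (1::complex)"
    using uv by (metis of_int_1 of_int_add of_int_mult)
  have "w1 = (of_int u * of_int m + of_int v * of_int n) * w1" unfolding uvc by simp
  also have "\<dots> = of_int u * (of_int m * w1 + of_int n * w2) - of_int n * om0"
    by (simp add: om0_def algebra_simps)
  finally have w1: "w1 = of_int u - of_int n * om0" unfolding mn[symmetric] by simp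
  have "w2 = (of_int u * of_int m + of_int v * of_int n) * w2" unfolding uvc by simp
  also have "\<dots> = of_int v * (of_int m * w1 + of_int n * w2) + of_int m * om0"
    by (simp add: om0_def algebra_simps)
  finally have w2: "w2 = of_int v + of_int m * om0" unfolding mn[symmetric] by simp
  have "w1 * cnj w2 - w2 * cnj w1 =
      (of_int u * of_int m + of_int v * of_int n) * (cnj om0 - om0)"
    unfolding w1 w2 by (simp add: algebra_simps)
  then have "w1 * cnj w2 - w2 * cnj w1 = cnj om0 - om0" unfolding uvc by simp
  also have "\<dots> = - (2 * \<i> * of_real (Im om0))" by (simp add: complex_eq_iff)
  finally have "complex_of_real (of_int \<Delta>) = of_real (- 4 * (Im om0)\<^sup>2)"
    using disc by (simp add: power_mult_distrib)
  then have disc': "of_int \<Delta> = - 4 * (Im om0)\<^sup>2" by (simp only: of_real_eq_iff)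
  define h where "h = Im om"
  have h2: "of_int \<Delta> = - 4 * h\<^sup>2" using disc' by (simp add: h_def om_def)
  have "real_of_int \<Delta> \<le> -15" using Dle by simp
  then have hl: "h\<^sup>2 \<ge> 15 / 4" using h2 by simp
  then have "h \<noteq> 0" by auto
  then have hpos: "h > 0" by (auto simp: h_def om_def)
  have rep: "\<exists>a b::int. x = of_int a + of_int b * om" if x: "x \<in> R" for x
  proof -
    obtain a b :: int where "x = of_int a * w1 + of_int b * w2" using x R_iff by blast
    then have "x = of_int (a * u + b * v) + of_int (b * m - a * n) * om0"
      by (subst (asm) w1, subst (asm) w2) (simp add: algebra_simps)
    also have "om0 = om \<or> om0 = - om" by (auto simp: om_def)
    then have "of_int (a * u + b * v) + of_int (b * m - a * n) * om0 =
        of_int (a * u + b * v) + of_int (if om0 = om then b * m - a * n else a * n - b * m) * om"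
      by (auto simp: algebra_simps)
    finally show ?thesis by blast
  qed
  have Im: "\<exists>k::int. Im x = h * of_int k" if "x \<in> R" for x
    using rep[OF that] by (auto simp: h_def mult.commute)
  \<comment> \<open>\<open>cnj om\<close> is the trace minus \<open>om\<close>; the trace is
    rational, so this lies in \<open>K\<close>, and conjugation preserves algebraic
    integers.\<close>
  have cnjR: "cnj om \<in> R"
  proof -
    obtain q where q: "om + cnj om = of_rat q"
      using imaginary_quadratic_trace_rational[OF K, of om] omR
      by (auto simp: R_def ring_of_integers_def Rats_def)
    have "of_rat q \<in> K"
    proof -
      obtain k l where kl: "quotient_of q = (k, l)" by fastforce
      have int: "of_int i \<in> K" for i
      proof -
        have "of_int i * 1 + of_int 0 * 1 \<in> R" using lin one by blast
        then show ?thesis by (simp add: R_def ring_of_integers_def)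
      qed
      have "of_int k * inverse (of_int l) \<in> K"
        using K int by (auto simp: imaginary_quadratic_field_def complex_subfield_def)
      then show ?thesis unfolding quotient_of_div[OF kl] of_rat_divide of_rat_of_int_eq
        by (simp add: divide_inverse)
    qed
    moreover have "cnj om = of_rat q - om" using q by (simp add: algebra_simps)
    ultimately have "cnj om \<in> K" using omR K_ring(3) by (simp add: R_def ring_of_integers_def)
    then show ?thesis using omR by (simp add: R_def ring_of_integers_def)
  qed
  have cnjx: "cnj x \<in> R" if x: "x \<in> R" for x
  proof -
    obtain a b :: int where "x = of_int a + of_int b * om" using rep x by blast
    then have "cnj x = of_int a * 1 + of_int b * cnj om" by simp
    also have "\<dots> \<in> R" by (rule lin[OF one cnjR])
    finally show ?thesis .
  qed
  have "om + cnj om \<in> R" using lin[OF omR cnjR, of 1 1] by simp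
  then have "om + cnj om \<in> \<int>" by (intro real) auto
  then obtain t :: int where t: "om + cnj om = of_int t" by (elim Ints_cases)
  have sq: "om\<^sup>2 \<in> R" using omR K_ring(4)[of om om] algebraic_int_square[of om]
    by (auto simp: R_def ring_of_integers_def power2_eq_square)
  have nrm: "om * cnj om = of_int t * om - om\<^sup>2"
    unfolding t[symmetric] by (simp add: algebra_simps power2_eq_square)
  have "of_int t * om + of_int (-1) * om\<^sup>2 \<in> R" by (rule lin[OF omR sq])
  then have "om * cnj om \<in> R" unfolding nrm by simp
  then have "om * cnj om \<in> \<int>" by (intro real) auto
  then obtain N :: int where N: "om * cnj om = of_int N" by (elim Ints_cases)
  have omsq: "om * om = of_int t * om - of_int N"
    using nrm N by (simp add: power2_eq_square algebra_simps)
  have mult: "x * y \<in> R" if xy: "x \<in> R" "y \<in> R" for x y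
  proof -
    obtain a b c d :: int where "x = of_int a + of_int b * om" "y = of_int c + of_int d * om"
      using rep xy by meson
    then have "x * y = of_int (a * c) + of_int (a * d + b * c) * om + of_int (b * d) * (om * om)"
      by (simp add: algebra_simps)
    also have "\<dots> = of_int (a * c - b * d * N) * 1 + of_int (a * d + b * c + b * d * t) * om"
      unfolding omsq by (simp add: algebra_simps)
    also have "\<dots> \<in> R" by (rule lin[OF one omR])
    finally show ?thesis .
  qed
  have far: "2 \<le> cmod (om + of_int i)" for i :: int
  proof -
    have re: "2 * Re om = of_int t" using arg_cong[OF t, of Re] by simp
    have nrm': "(Re om)\<^sup>2 + h\<^sup>2 = of_int N"
      using arg_cong[OF N, of Re] by (simp add: h_def power2_eq_square)
    then have "real_of_int (N + i * t + i * i) = (Re om + of_int i)\<^sup>2 + h\<^sup>2"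
      unfolding of_int_add of_int_mult re[symmetric] nrm'[symmetric]
      by (simp add: power2_eq_square algebra_simps)
    moreover have "(Re om + of_int i)\<^sup>2 + h\<^sup>2 > 3"
      using hl zero_le_power2[of "Re om + of_int i"] by linarith
    ultimately have "real_of_int (N + i * t + i * i) > 3" by simp
    then have "N + i * t + i * i \<ge> 4" by linarith
    then have "real_of_int (N + i * t + i * i) \<ge> 4" by linarith
    then have "4 \<le> (Re om + of_int i)\<^sup>2 + h\<^sup>2"
      using \<open>real_of_int (N + i * t + i * i) = (Re om + of_int i)\<^sup>2 + h\<^sup>2\<close> by simp
    then have "2\<^sup>2 \<le> (cmod (om + of_int i))\<^sup>2" by (simp add: cmod_power2 h_def)
    then show ?thesis by (rule power2_le_imp_le) simp
  qed
  have "quadratic_order R om h"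
    by unfold_locales (use one diff mult cnjx omR h_def hpos hl Im real far in auto)
  then show ?thesis unfolding R_def by blast
qed

section \<open>Hermitian forms\<close>

definition lin :: "complex \<Rightarrow> complex \<Rightarrow> complex \<Rightarrow> complex \<Rightarrow> complex \<times> complex \<Rightarrow> complex \<times> complex" where
  "lin a b c d = (\<lambda>(z, w). (a * z + b * w, c * z + d * w))"

lemma lin_apply [simp]: "lin a b c d (z, w) = (a * z + b * w, c * z + d * w)"
  by (simp add: lin_def)

lemma lin_comp:
  "lin a b c d \<circ> lin a' b' c' d' = lin (a*a' + b*c') (a*b' + b*d') (c*a' + d*c') (c*b' + d*d')"
  by (auto simp: fun_eq_iff algebra_simps)

lemma lin_id: "lin 1 0 0 1 = id"
  by (auto simp: fun_eq_iff)

lemma lin_cong: "a = a' \<Longrightarrow> b = b' \<Longrightarrow> c = c' \<Longrightarrow> d = d' \<Longrightarrow> lin a b c d = lin a' b' c' d'"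
  by simp

text \<open>Determinant \<open>-1\<close> is allowed so that both orientations of a circle lie in one orbit.\<close>

definition unimodular :: "complex set \<Rightarrow> (complex \<times> complex \<Rightarrow> complex \<times> complex) set" where
  "unimodular R = {lin a b c d | a b c d.
     a \<in> R \<and> b \<in> R \<and> c \<in> R \<and> d \<in> R \<and> (a * d - b * c = 1 \<or> a * d - b * c = -1)}"

text \<open>The matrix has zero diagonal and off-diagonal entries \<open>\<plusminus> \<i>\<close>,
  so the determinant is -1. The form is negative on the upper half-plane, the left side of rightward
  travel.\<close>

definition real_form :: "complex \<times> complex \<Rightarrow> real" where
  "real_form = (\<lambda>(z, w). - 2 * Im (z * cnj w))"

lemma real_form_apply [simp]: "real_form (z, w) = - 2 * Im (z * cnj w)"
  by (simp add: real_form_def)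

definition bianchi_forms :: "complex set \<Rightarrow> (complex \<times> complex \<Rightarrow> real) set" where
  "bianchi_forms R = (\<lambda>f. real_form \<circ> f) ` unimodular R"

text \<open>A common nonzero zero and \<open>P \<noteq> - Q\<close> express tangency: circles with
  disjoint interiors and more than one common point coincide with opposite orientations. In this
  shape every clause is visibly invariant under linear substitution.\<close>

definition adjacent_forms ::
    "complex set \<Rightarrow> (complex \<times> complex \<Rightarrow> real) \<Rightarrow> (complex \<times> complex \<Rightarrow> real) \<Rightarrow> bool" where
  "adjacent_forms R P Q \<longleftrightarrow> P \<in> bianchi_forms R \<and> Q \<in> bianchi_forms R \<and>
     (\<exists>v. P v \<noteq> - Q v) \<and>
     (\<exists>v. v \<noteq> 0 \<and> P v = 0 \<and> Q v = 0) \<and> \<not> (\<exists>v. P v < 0 \<and> Q v < 0) \<and>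
     \<not> (\<exists>B \<in> bianchi_forms R. (\<exists>v. (P v = 0 \<or> Q v = 0) \<and> B v < 0) \<and>
          (\<exists>v. (P v = 0 \<or> Q v = 0) \<and> B v > 0))"

lemma adjacent_forms_sym: "adjacent_forms R P Q \<Longrightarrow> adjacent_forms R Q P"
  unfolding adjacent_forms_def by (metis minus_minus)

fun nonbacktracking :: "('a \<Rightarrow> 'a \<Rightarrow> bool) \<Rightarrow> 'a list \<Rightarrow> bool" where
  "nonbacktracking r (x # y # z # zs) \<longleftrightarrow> r x y \<and> x \<noteq> z \<and> nonbacktracking r (y # z # zs)"
| "nonbacktracking r [x, y] \<longleftrightarrow> r x y"
| "nonbacktracking r _ \<longleftrightarrow> True"

lemma nonbacktracking_map:
  assumes "nonbacktracking r xs" and "\<And>x y. r x y \<Longrightarrow> r (f x) (f y)" and "inj f"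
  shows "nonbacktracking r (map f xs)"
  using assms by (induction r xs rule: nonbacktracking.induct) (auto simp: inj_eq)

lemma nonbacktracking_if_distinct:
  "successively r xs \<Longrightarrow> distinct xs \<Longrightarrow> nonbacktracking r xs"
  by (induction r xs rule: nonbacktracking.induct) auto

lemma inj_comp_right: "surj f \<Longrightarrow> inj (\<lambda>P. P \<circ> f)"
  by (auto simp: inj_def fun_eq_iff) (metis surjD)

section \<open>Ping-pong\<close>

text \<open>In the coordinate \<open>z / w\<close> the hypothesis says that the point lies outside all open unit discs
  centred at integers; its imaginary part is then at least \<open>\<surd>3 / 2\<close> in absolute value. The
  disjunction serves both the weak and the strict form of the hypothesis.\<close>

lemma norm_int_combination_lower_bound:
  fixes z w :: complex and c d :: int
  assumes far: "\<And>n::int. cmod w \<le> cmod (z - of_int n * w)" and "c \<noteq> 0" and "w \<noteq> 0"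
  shows "cmod w < cmod (of_int c * z + of_int d * w) \<or>
    (\<exists>n::int. cmod (of_int c * z + of_int d * w) = cmod (z - of_int n * w))"
proof -
  \<comment> \<open>For \<open>\<bar>c\<bar> = 1\<close> the combination is, up to sign,
    \<open>z\<close> minus an integer multiple of \<open>w\<close>. For
    \<open>\<bar>c\<bar> \<ge> 2\<close> the imaginary part alone gives modulus at least
    \<open>sqrt 3\<close> relative to \<open>w\<close>.\<close>
  consider "c = 1" | "c = -1" | "2 \<le> \<bar>c\<bar>" using \<open>c \<noteq> 0\<close> by linarith
  then show ?thesis
  proof cases
    case 1
    have "of_int c * z + of_int d * w = z - of_int (- d) * w" using 1 by simp
    then show ?thesis by metis
  next
    case 2
    have "of_int c * z + of_int d * w = - (z - of_int d * w)" using 2 by simp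
    then show ?thesis by (metis norm_minus_cancel)
  next
    case 3
    define \<tau> where "\<tau> = z / w"
    have z: "z = \<tau> * w" using \<open>w \<noteq> 0\<close> by (simp add: \<tau>_def)
    define n where "n = round (Re \<tau>)"
    have "cmod w * 1 \<le> cmod w * cmod (\<tau> - of_int n)"
      using far[of n] unfolding z by (simp flip: norm_mult add: algebra_simps)
    then have "1 \<le> cmod (\<tau> - of_int n)" using \<open>w \<noteq> 0\<close> by (metis mult_le_cancel_left_pos zero_less_norm_iff)
    then have "1 \<le> (cmod (\<tau> - of_int n))\<^sup>2" by simp
    also have "\<dots> = (Re \<tau> - of_int n)\<^sup>2 + (Im \<tau>)\<^sup>2" by (simp add: cmod_power2)
    finally have "1 \<le> (Re \<tau> - of_int n)\<^sup>2 + (Im \<tau>)\<^sup>2" .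
    moreover have "\<bar>Re \<tau> - of_int n\<bar> \<le> 1 / 2"
      using of_int_round_abs_le[of "Re \<tau>"] by (simp add: n_def abs_minus_commute)
    then have "(Re \<tau> - of_int n)\<^sup>2 \<le> (1 / 2)\<^sup>2" by (metis abs_ge_zero power2_abs power_mono)
    ultimately have "3 / 4 \<le> (Im \<tau>)\<^sup>2" by (simp add: power2_eq_square)
    moreover have "(2::real)\<^sup>2 \<le> (of_int \<bar>c\<bar>)\<^sup>2" using 3 by (intro power_mono) auto
    then have "4 \<le> (real_of_int c)\<^sup>2" by simp
    ultimately have "4 * (3 / 4) \<le> (real_of_int c)\<^sup>2 * (Im \<tau>)\<^sup>2" by (intro mult_mono) auto
    also have "\<dots> \<le> (cmod (of_int c * \<tau> + of_int d))\<^sup>2"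
      by (simp add: cmod_power2 power_mult_distrib)
    finally have "1 < (cmod (of_int c * \<tau> + of_int d))\<^sup>2" by simp
    then have "1 < cmod (of_int c * \<tau> + of_int d)"
      by (metis norm_ge_zero one_power2 power_less_imp_less_base)
    then have "cmod w * 1 < cmod w * cmod (of_int c * \<tau> + of_int d)"
      using \<open>w \<noteq> 0\<close> by (intro mult_strict_left_mono) auto
    then show ?thesis unfolding z by (simp flip: norm_mult add: algebra_simps)
  qed
qed

text \<open>Homogeneous version of the closed unit discs around the integers; infinity, where
  \<open>w = 0\<close> and \<open>z \<noteq> 0\<close>, is near no integer and counts as far
  below.\<close>

definition near_integer :: "complex \<times> complex \<Rightarrow> bool" where
  "near_integer = (\<lambda>(z, w). \<exists>n::int. cmod (z - of_int n * w) \<le> cmod w)"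

definition far_from_integers :: "complex \<times> complex \<Rightarrow> bool" where
  "far_from_integers = (\<lambda>(z, w). \<forall>n::int. cmod w \<le> cmod (z - of_int n * w))"

text \<open>If the image \<open>(z', w')\<close> were not near an integer, then bounding \<open>w'\<close> in terms of \<open>(z, w)\<close> and
  \<open>w\<close> in terms of \<open>(z', w')\<close> would give \<open>\<bar>w\<bar> \<le> \<bar>w'\<bar> < \<bar>w\<bar>\<close>.\<close>

lemma near_integer_modular:
  fixes p q s t :: int
  assumes far: "far_from_integers v" and det: "p * t - q * s = 1" and s: "s \<noteq> 0"
  shows "near_integer (lin (of_int p) (of_int q) (of_int s) (of_int t) v)"
proof (rule ccontr)
  obtain z w where v: "v = (z, w)" by (cases v)
  define z' where "z' = of_int p * z + of_int q * w"
  define w' where "w' = of_int s * z + of_int t * w"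
  assume "\<not> ?thesis"
  then have strict: "cmod w' < cmod (z' - of_int n * w')" for n :: int
    by (auto simp: near_integer_def v z'_def w'_def not_le)
  have fz: "cmod w \<le> cmod (z - of_int n * w)" for n :: int
    using far by (simp add: far_from_integers_def v)
  \<comment> \<open>The lower row of the inverse matrix, with the nonzero entry \<open>- s\<close>,
    lets the same bound be applied backwards.\<close>
  have "w = (of_int p * of_int t - of_int q * of_int s) * w"
    using arg_cong[OF det, of complex_of_int] by simp
  also have "\<dots> = of_int (- s) * z' + of_int p * w'"
    by (simp add: z'_def w'_def algebra_simps)
  finally have w: "w = of_int (- s) * z' + of_int p * w'" .
  have "cmod w \<le> cmod w'"
  proof (cases "w = 0")
    case False
    then show ?thesis
      using norm_int_combination_lower_bound[OF fz s False, of t] fz unfolding w'_def by fastforce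
  qed simp
  moreover have "cmod w' < cmod w"
  proof (cases "w' = 0")
    case True
    then show ?thesis using strict[of 0] s w by simp
  next
    case False
    have "- s \<noteq> 0" using s by simp
    from norm_int_combination_lower_bound[OF less_imp_le[OF strict] this False, of p]
    show ?thesis using strict unfolding w[symmetric] by fastforce
  qed
  ultimately show False by simp
qed

text \<open>A binary quadratic form of discriminant 0 is a multiple of the square of a primitive
  linear form: \<open>a x^2 + 2 j x y + c y^2 = k (s x + t y)^2\<close>. The coprime pair
  \<open>(s, t)\<close> is then completed to a modular matrix.\<close>

lemma int_square_eq_mult:
  fixes a c j :: int
  assumes "j * j = a * c"
  shows "\<exists>k s t p q. a = k * (s * s) \<and> c = k * (t * t) \<and> j = k * (s * t) \<and> p * t - q * s = 1"
proof (cases "a = 0")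
  case True
  with assms show ?thesis
    by (intro exI[of _ c] exI[of _ 0] exI[of _ 1] exI[of _ 1] exI[of _ 0]) auto
next
  case False
  define g where "g = gcd a j"
  have g: "g \<noteq> 0" using False by (simp add: g_def)
  obtain s t where st: "a = s * g" "j = t * g" "coprime s t"
    using gcd_coprime_exists[of a j] g unfolding g_def by blast
  have "s * c * g = a * c" by (simp add: st)
  also have "\<dots> = j * j" by (simp add: assms)
  also have "\<dots> = (t * t * g) * g" by (simp add: st)
  finally have "s * c * g = (t * t * g) * g" .
  then have sc: "s * c = t * t * g" using mult_right_cancel[OF g] by blast
  then have "s dvd t * t * g" by (metis dvd_triv_left)
  then have "s dvd g" using st(3) by (simp add: coprime_dvd_mult_right_iff)
  then obtain k where k: "g = s * k" by blast
  have "s \<noteq> 0" using False st by auto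
  have "s * c = s * (k * (t * t))" using sc by (simp add: k algebra_simps)
  then have c: "c = k * (t * t)" using \<open>s \<noteq> 0\<close> by simp
  obtain u v where "u * s + v * t = 1"
    using bezout_int[of s t] st(3) by (auto simp: coprime_iff_gcd_eq_1)
  then have "v * t - (- u) * s = 1" by simp
  moreover have "a = k * (s * s)" "j = k * (s * t)" using st k by auto
  ultimately show ?thesis using c by blast
qed

section \<open>Unimodular substitutions and the half-turn\<close>

context quadratic_order
begin

lemma zero_closed: "0 \<in> R"
  using diff_closed[OF one_closed one_closed] by simp

lemma minus_closed: "x \<in> R \<Longrightarrow> - x \<in> R"
  using diff_closed[OF zero_closed] by simp

lemma add_closed: "x \<in> R \<Longrightarrow> y \<in> R \<Longrightarrow> x + y \<in> R"
  using diff_closed[of x "- y"] minus_closed by simp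

lemma of_int_closed: "of_int n \<in> R"
proof (induction n rule: int_induct[where k = 0])
  case base
  show ?case using zero_closed by simp
next
  case (step1 i)
  then show ?case using add_closed[OF _ one_closed, of "of_int i"] by simp
next
  case (step2 i)
  then show ?case using diff_closed[OF _ one_closed, of "of_int i"] by simp
qed

lemmas ring_closed = one_closed zero_closed minus_closed add_closed diff_closed mult_closed
  of_int_closed omega_closed

lemma unimodular_comp:
  assumes "f \<in> unimodular R" "g \<in> unimodular R"
  shows "f \<circ> g \<in> unimodular R"
proof -
  obtain a b c d where f: "f = lin a b c d" "a \<in> R" "b \<in> R" "c \<in> R" "d \<in> R"
      "a * d - b * c = 1 \<or> a * d - b * c = -1"
    using assms(1) by (auto simp: unimodular_def)
  obtain a' b' c' d' where g: "g = lin a' b' c' d'" "a' \<in> R" "b' \<in> R" "c' \<in> R" "d' \<in> R"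
      "a' * d' - b' * c' = 1 \<or> a' * d' - b' * c' = -1"
    using assms(2) by (auto simp: unimodular_def)
  have "(a*a' + b*c') * (c*b' + d*d') - (a*b' + b*d') * (c*a' + d*c') =
      (a * d - b * c) * (a' * d' - b' * c')" by (simp add: algebra_simps)
  then have "(a*a' + b*c') * (c*b' + d*d') - (a*b' + b*d') * (c*a' + d*c') = 1 \<or>
      (a*a' + b*c') * (c*b' + d*d') - (a*b' + b*d') * (c*a' + d*c') = -1"
    using f(6) g(6) by (elim disjE) simp_all
  then show ?thesis
    unfolding f(1) g(1) lin_comp unimodular_def using f g by (blast intro: ring_closed)
qed

lemma unimodular_inverse:
  assumes "f \<in> unimodular R"
  obtains g where "g \<in> unimodular R" "f \<circ> g = id" "g \<circ> f = id"
proof -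
  obtain a b c d where f: "f = lin a b c d" "a \<in> R" "b \<in> R" "c \<in> R" "d \<in> R"
      "a * d - b * c = 1 \<or> a * d - b * c = -1"
    using assms by (auto simp: unimodular_def)
  define e where "e = a * d - b * c"
  have e: "e * e = 1" "e \<in> R" using f by (auto simp: e_def intro!: ring_closed)
  define g where "g = lin (e * d) (- (e * b)) (- (e * c)) (e * a)"
  have fg: "f \<circ> g = lin (e * e) 0 0 (e * e)" and gf: "g \<circ> f = lin (e * e) 0 0 (e * e)"
    unfolding f(1) g_def lin_comp by (rule lin_cong; simp add: e_def algebra_simps)+
  have "f \<circ> g = id" "g \<circ> f = id" using fg gf by (simp_all add: e lin_id)
  moreover have "(e * d) * (e * a) - (- (e * b)) * (- (e * c)) = (e * e) * e"
    by (simp add: e_def algebra_simps)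
  then have "(e * d) * (e * a) - (- (e * b)) * (- (e * c)) = 1 \<or>
      (e * d) * (e * a) - (- (e * b)) * (- (e * c)) = -1"
    using f(6) by (simp add: e(1)) (simp add: e_def)
  then have "g \<in> unimodular R"
    unfolding g_def unimodular_def using f(2-5) e(2) by (blast intro: ring_closed)
  ultimately show thesis using that by blast
qed

lemma unimodular_surj: "f \<in> unimodular R \<Longrightarrow> surj f"
  by (metis unimodular_inverse comp_apply id_apply surjI)

lemma unimodular_nonzero: "f \<in> unimodular R \<Longrightarrow> v \<noteq> 0 \<Longrightarrow> f v \<noteq> 0"
proof
  assume f: "f \<in> unimodular R" and v: "v \<noteq> 0" "f v = 0"
  obtain g where g: "g \<in> unimodular R" "g \<circ> f = id" using f by (rule unimodular_inverse)
  then have "v = g 0" using v(2) by (metis comp_apply id_apply)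
  with g(1) v(1) show False by (auto simp: unimodular_def zero_prod_def)
qed

lemma bianchi_forms_comp: "P \<in> bianchi_forms R \<Longrightarrow> f \<in> unimodular R \<Longrightarrow> P \<circ> f \<in> bianchi_forms R"
  by (auto simp: bianchi_forms_def comp_assoc intro!: imageI unimodular_comp)

lemma adjacent_forms_comp:
  assumes adj: "adjacent_forms R P Q" and f: "f \<in> unimodular R"
  shows "adjacent_forms R (P \<circ> f) (Q \<circ> f)"
proof -
  obtain g where g: "g \<in> unimodular R" "f \<circ> g = id" "g \<circ> f = id" using f by (rule unimodular_inverse)
  have fg: "f (g v) = v" for v using g(2) by (metis comp_apply id_apply)
  have "\<not> (\<exists>B \<in> bianchi_forms R. (\<exists>v. ((P \<circ> f) v = 0 \<or> (Q \<circ> f) v = 0) \<and> B v < 0) \<and>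
          (\<exists>v. ((P \<circ> f) v = 0 \<or> (Q \<circ> f) v = 0) \<and> B v > 0))"
  proof
    assume "\<exists>B \<in> bianchi_forms R. (\<exists>v. ((P \<circ> f) v = 0 \<or> (Q \<circ> f) v = 0) \<and> B v < 0) \<and>
          (\<exists>v. ((P \<circ> f) v = 0 \<or> (Q \<circ> f) v = 0) \<and> B v > 0)"
    then obtain B v v' where B: "B \<in> bianchi_forms R"
      "P (f v) = 0 \<or> Q (f v) = 0" "B v < 0" "P (f v') = 0 \<or> Q (f v') = 0" "B v' > 0"
      unfolding comp_apply by blast
    have gf: "g (f v) = v" for v using g(3) by (metis comp_apply id_apply)
    have "B \<circ> g \<in> bianchi_forms R" using B(1) g(1) by (rule bianchi_forms_comp)
    moreover have "(B \<circ> g) (f v) < 0" "(B \<circ> g) (f v') > 0" using B gf by auto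
    ultimately show False using adj B(2,4) unfolding adjacent_forms_def by blast
  qed
  moreover from adj obtain v where "v \<noteq> 0" "P v = 0" "Q v = 0" by (auto simp: adjacent_forms_def)
  then have "\<exists>v. v \<noteq> 0 \<and> (P \<circ> f) v = 0 \<and> (Q \<circ> f) v = 0"
    using unimodular_nonzero[OF g(1)] fg by (intro exI[of _ "g v"]) auto
  moreover from adj obtain v where "P v \<noteq> - Q v" by (auto simp: adjacent_forms_def)
  then have "(P \<circ> f) (g v) \<noteq> - (Q \<circ> f) (g v)" by (simp add: fg)
  then have "\<exists>v. (P \<circ> f) v \<noteq> - (Q \<circ> f) v" by blast
  moreover have "P \<circ> f \<in> bianchi_forms R" "Q \<circ> f \<in> bianchi_forms R"
    using adj f by (auto simp: adjacent_forms_def intro: bianchi_forms_comp)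
  moreover have "\<not> (\<exists>v. (P \<circ> f) v < 0 \<and> (Q \<circ> f) v < 0)"
    using adj unfolding adjacent_forms_def comp_apply by blast
  ultimately show ?thesis unfolding adjacent_forms_def by blast
qed

text \<open>The form of the line \<open>Im z = - h\<close> with its lower side as interior.\<close>

definition low_form :: "complex \<times> complex \<Rightarrow> real" where
  "low_form = (\<lambda>(z, w). 2 * h * (cmod w)\<^sup>2 + 2 * Im (z * cnj w))"

text \<open>The half-turn \<open>z \<mapsto> - z - \<omega>\<close> about
  \<open>- \<omega> / 2\<close>.\<close>

definition swap :: "complex \<times> complex \<Rightarrow> complex \<times> complex" where
  "swap = lin (-1) (- \<omega>) 0 1"

lemma swap_unimodular: "swap \<in> unimodular R"
  unfolding swap_def unimodular_def
  by (rule CollectI, intro exI conjI, rule refl) (auto intro: ring_closed)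

lemma swap_swap: "swap (swap v) = v"
  by (cases v) (simp add: swap_def)

lemma real_form_swap: "real_form \<circ> swap = low_form"
  by (simp add: fun_eq_iff swap_def low_form_def cmod_power2 Im_omega)
    (simp add: algebra_simps power2_eq_square)

lemma low_form_swap: "low_form \<circ> swap = real_form"
  by (auto simp flip: real_form_swap simp: fun_eq_iff swap_swap)

lemma h_ge_1: "h \<ge> 1"
  using h_large h_pos by (smt (verit) power_le_one divide_le_eq_1)

text \<open>A point at height \<open>- h\<close> has distance at least \<open>h \<ge> 1\<close> from
  every integer; the estimate is this one multiplied by \<open>(cmod w)^2\<close>.\<close>

lemma far_if_low_form_zero:
  assumes "low_form v = 0"
  shows "far_from_integers v"
proof (cases v)
  case (Pair z w)
  show ?thesis unfolding far_from_integers_def Pair prod.case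
  proof
    fix n :: int
    have "h * (cmod w)\<^sup>2 = - Im (z * cnj w)" using assms by (simp add: Pair low_form_def)
    also have "\<dots> = - Im ((z - of_int n * w) * cnj w)" by (simp add: algebra_simps)
    also have "\<dots> \<le> cmod ((z - of_int n * w) * cnj w)"
      using abs_Im_le_cmod[of "(z - of_int n * w) * cnj w"] by linarith
    also have "\<dots> = cmod (z - of_int n * w) * cmod w" by (simp add: norm_mult)
    finally have *: "h * (cmod w)\<^sup>2 \<le> cmod (z - of_int n * w) * cmod w" .
    have "1 * (cmod w)\<^sup>2 \<le> h * (cmod w)\<^sup>2" using h_ge_1 by (intro mult_right_mono) auto
    with * have "cmod w * cmod w \<le> cmod (z - of_int n * w) * cmod w"
      by (simp add: power2_eq_square)
    then show "cmod w \<le> cmod (z - of_int n * w)"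
      by (cases "w = 0") (auto dest: mult_right_le_imp_le)
  qed
qed

text \<open>Triangle inequality: a disc centre in the row \<open>- \<omega> + \<int>\<close> and an
  integer are at least 2 apart by \<open>omega_far\<close>, so a point within 1 of the former is at
  least 1 away from the latter.\<close>

lemma far_if_near_swap:
  assumes "near_integer (swap v)"
  shows "far_from_integers v"
proof (cases v)
  case (Pair z w)
  obtain n :: int where n: "cmod (- z - \<omega> * w - of_int n * w) \<le> cmod w"
    using assms by (auto simp: Pair swap_def near_integer_def)
  show ?thesis unfolding far_from_integers_def Pair prod.case
  proof
    fix m :: int
    have "2 * cmod w \<le> cmod (\<omega> + of_int (n + m)) * cmod w"
      using omega_far[of "n + m"] by (intro mult_right_mono norm_ge_zero)
    also have "\<dots> = cmod (- (- z - \<omega> * w - of_int n * w) - (z - of_int m * w))"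
      by (simp flip: norm_mult add: algebra_simps)
    also have "\<dots> \<le> cmod (- (- z - \<omega> * w - of_int n * w)) + cmod (z - of_int m * w)"
      by (rule norm_triangle_ineq4)
    also have "\<dots> \<le> cmod w + cmod (z - of_int m * w)" using n by (simp only: norm_minus_cancel)
    finally show "cmod w \<le> cmod (z - of_int m * w)" by simp
  qed
qed

end

section \<open>Neighbours of the real line\<close>

lemma real_form_lin:
  "real_form (lin \<alpha> \<beta> \<gamma> \<delta> (z, w)) =
     - 2 * Im (\<alpha> * cnj \<gamma>) * (cmod z)\<^sup>2 - 2 * Im (\<beta> * cnj \<delta>) * (cmod w)\<^sup>2
     - 2 * Im (z * cnj w * (\<alpha> * cnj \<delta> - cnj \<beta> * \<gamma>))"
  by (simp add: cmod_power2) (simp add: algebra_simps power2_eq_square)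

text \<open>A substitution multiplies the determinant of a Hermitian form by the squared modulus of
  its own determinant; the left side is minus the determinant of the form in
  \<open>real_form_lin\<close>.\<close>

lemma hermitian_determinant:
  "(cmod (\<alpha> * cnj \<delta> - cnj \<beta> * \<gamma>))\<^sup>2 - 4 * Im (\<alpha> * cnj \<gamma>) * Im (\<beta> * cnj \<delta>) =
    (cmod (\<alpha> * \<delta> - \<beta> * \<gamma>))\<^sup>2"
  by (simp add: cmod_power2) (simp add: algebra_simps power2_eq_square)

lemma Im_modular:
  fixes p q s t :: int
  assumes "p * t - q * s = 1"
  shows "Im ((of_int p * z + of_int q * w) * cnj (of_int s * z + of_int t * w)) = Im (z * cnj w)"
proof -
  have "Im ((of_int p * z + of_int q * w) * cnj (of_int s * z + of_int t * w)) =
      of_int (p * t - q * s) * Im (z * cnj w)"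
    by (simp add: algebra_simps)
  then show ?thesis using assms by simp
qed

context quadratic_order
begin

abbreviation int_lin :: "int \<Rightarrow> int \<Rightarrow> int \<Rightarrow> int \<Rightarrow> complex \<times> complex \<Rightarrow> complex \<times> complex" where
  "int_lin p q s t \<equiv> lin (of_int p) (of_int q) (of_int s) (of_int t)"

lemma int_lin_unimodular: "p * t - q * s = 1 \<Longrightarrow> int_lin p q s t \<in> unimodular R"
proof -
  assume "p * t - q * s = 1"
  then have "of_int p * of_int t - of_int q * of_int s = (1::complex)"
    by (metis of_int_1 of_int_diff of_int_mult)
  then show ?thesis unfolding unimodular_def using of_int_closed by blast
qed

lemma int_lin_inverse:
  assumes "p * t - q * s = 1"
  shows "int_lin p q s t (int_lin t (- q) (- s) p v) = v"
    and "int_lin t (- q) (- s) p (int_lin p q s t v) = v"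
proof -
  have d: "of_int p * of_int t = 1 + of_int q * (of_int s :: complex)"
    using arg_cong[OF assms, of complex_of_int] by (simp add: algebra_simps)
  obtain z w where v: "v = (z, w)" by (cases v)
  have "of_int p * (of_int t * z) = z + of_int q * (of_int s * z)" for z :: complex
    using arg_cong[OF d, of "\<lambda>x. x * z"] by (simp add: algebra_simps)
  moreover from this have "of_int t * (of_int p * z) = z + of_int q * (of_int s * z)" for z :: complex
    by (metis mult.left_commute)
  ultimately show "int_lin p q s t (int_lin t (- q) (- s) p v) = v"
      "int_lin t (- q) (- s) p (int_lin p q s t v) = v"
    by (simp_all add: v algebra_simps)
qed

lemma real_form_int_lin: "p * t - q * s = 1 \<Longrightarrow> real_form (int_lin p q s t v) = real_form v"
  by (cases v) (simp only: lin_apply real_form_apply Im_modular)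

lemma low_form_bianchi: "low_form \<in> bianchi_forms R"
  unfolding real_form_swap[symmetric] bianchi_forms_def using swap_unimodular by (rule imageI)

text \<open>Circles in the orbit can only meet the real line tangentially: the middle coefficient has real
  part \<open>\<plusminus> 1 + 2 h\<^sup>2 k\<close>, a common point forces its absolute value to be at most 1, and
  \<open>2 h\<^sup>2 > 2\<close> leaves \<open>k = 0\<close>. What remains is an integral binary quadratic form of discriminant 0.\<close>

lemma real_form_neighbour_shape:
  assumes adj: "adjacent_forms R real_form Q"
  shows "\<exists>p q s t k e :: int. p * t - q * s = 1 \<and> (e = 1 \<or> e = -1) \<and>
    (\<forall>z w. Q (z, w) = 2 * h * of_int k * (cmod (snd (int_lin p q s t (z, w))))\<^sup>2
       - 2 * of_int e * Im (z * cnj w))"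
proof -
  from adj have "Q \<in> bianchi_forms R" by (simp add: adjacent_forms_def)
  then obtain \<alpha> \<beta> \<gamma> \<delta> where Q: "Q = real_form \<circ> lin \<alpha> \<beta> \<gamma> \<delta>"
    and R: "\<alpha> \<in> R" "\<beta> \<in> R" "\<gamma> \<in> R" "\<delta> \<in> R"
    and "\<alpha> * \<delta> - \<beta> * \<gamma> = 1 \<or> \<alpha> * \<delta> - \<beta> * \<gamma> = -1"
    by (auto simp: bianchi_forms_def unimodular_def)
  then obtain e :: int where e: "\<alpha> * \<delta> - \<beta> * \<gamma> = of_int e" "e = 1 \<or> e = -1"
    by (metis of_int_1 of_int_minus)
  define \<kappa> where "\<kappa> = \<alpha> * cnj \<delta> - cnj \<beta> * \<gamma>"
  obtain a where a: "Im (\<alpha> * cnj \<gamma>) = h * of_int a"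
    using Im_multiple R by (meson cnj_closed mult_closed)
  obtain c where c: "Im (\<beta> * cnj \<delta>) = h * of_int c"
    using Im_multiple R by (meson cnj_closed mult_closed)
  obtain m where m: "Im \<delta> = h * of_int m" using Im_multiple R by blast
  obtain n where n: "Im \<beta> = h * of_int n" using Im_multiple R by blast
  \<comment> \<open>Writing \<open>cnj \<delta> = \<delta> - 2 \<i> Im \<delta>\<close>, and
    likewise for \<open>\<beta>\<close>, splits \<open>\<kappa>\<close> into the determinant
    \<open>e\<close> and \<open>- 2 \<i> h y\<close> with \<open>y\<close> in
    \<open>R\<close>.\<close>
  define y where "y = \<alpha> * of_int m - \<gamma> * of_int n"
  have yR: "y \<in> R" unfolding y_def using R by (intro ring_closed)
  obtain k where k: "Im y = h * of_int k" using Im_multiple yR by blast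
  have "cnj \<delta> = \<delta> - 2 * \<i> * h * of_int m" "cnj \<beta> = \<beta> - 2 * \<i> * h * of_int n"
    using m n by (simp_all add: complex_eq_iff)
  then have "\<kappa> = (\<alpha> * \<delta> - \<beta> * \<gamma>) - 2 * \<i> * h * y"
    unfolding \<kappa>_def y_def by (simp only:) (simp add: algebra_simps)
  then have \<kappa>: "\<kappa> = of_int e - 2 * \<i> * h * y" using e by simp
  have Re\<kappa>: "Re \<kappa> = of_int e + 2 * h\<^sup>2 * of_int k" and Im\<kappa>: "Im \<kappa> = - 2 * h * Re y"
    by (simp_all add: \<kappa> k power2_eq_square)
  have Qv: "Q (z, w) = - 2 * h * of_int a * (cmod z)\<^sup>2 - 2 * h * of_int c * (cmod w)\<^sup>2
      - 2 * Im (z * cnj w * \<kappa>)" for z w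
    unfolding Q comp_apply real_form_lin a c \<kappa>_def by (simp add: algebra_simps)
  have "(cmod (complex_of_int e))\<^sup>2 = 1" using e(2) by auto
  then have det: "(Re \<kappa>)\<^sup>2 + (Im \<kappa>)\<^sup>2 - 4 * h\<^sup>2 * of_int a * of_int c = 1"
    using hermitian_determinant[of \<alpha> \<delta> \<beta> \<gamma>] cmod_power2[of \<kappa>]
    unfolding a c e(1) \<kappa>_def[symmetric] by (simp add: algebra_simps power2_eq_square)
  obtain z w where zw: "(z, w) \<noteq> 0" "real_form (z, w) = 0" "Q (z, w) = 0"
    using adj unfolding adjacent_forms_def by auto
  have im0: "Im (z * cnj w) = 0" using zw(2) by simp
  define r where "r = Re (z * cnj w)"
  have "r\<^sup>2 = (cmod (z * cnj w))\<^sup>2" using im0 by (simp only: cmod_power2 r_def) simp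
  then have r2: "r\<^sup>2 = (cmod z)\<^sup>2 * (cmod w)\<^sup>2" by (simp add: norm_mult power_mult_distrib)
  have "Im (z * cnj w * \<kappa>) = Re (z * cnj w) * Im \<kappa> + Im (z * cnj w) * Re \<kappa>"
    by (rule times_complex.simps(2)[THEN trans]) simp
  then have "Im (z * cnj w * \<kappa>) = r * Im \<kappa>" using im0 by (simp add: r_def)
  then have q0: "r * Im \<kappa> = - h * (of_int a * (cmod z)\<^sup>2 + of_int c * (cmod w)\<^sup>2)"
    using zw(3) unfolding Qv by (simp add: algebra_simps)
  \<comment> \<open>On the real line \<open>Q\<close> is a real binary quadratic form with a
    nontrivial zero, so its discriminant is not negative.\<close>
  have "4 * h\<^sup>2 * of_int a * of_int c \<le> (Im \<kappa>)\<^sup>2"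
  proof (cases "r = 0")
    case True
    then have "z = 0 \<or> w = 0" using r2 by auto
    with q0 True h_pos zw(1) have "a = 0 \<or> c = 0" by (auto simp: zero_prod_def)
    then show ?thesis by auto
  next
    case False
    have "4 * h\<^sup>2 * of_int a * of_int c * r\<^sup>2 =
        4 * h\<^sup>2 * ((of_int a * (cmod z)\<^sup>2) * (of_int c * (cmod w)\<^sup>2))"
      by (simp add: r2)
    also have "\<dots> = h\<^sup>2 * (4 * ((of_int a * (cmod z)\<^sup>2) * (of_int c * (cmod w)\<^sup>2)))" by simp
    also have "\<dots> \<le> h\<^sup>2 * (of_int a * (cmod z)\<^sup>2 + of_int c * (cmod w)\<^sup>2)\<^sup>2"
    proof (rule mult_left_mono)
      have "4 * (x * y) \<le> (x + y)\<^sup>2" for x y :: real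
        using zero_le_power2[of "x - y"] by (simp add: power2_eq_square algebra_simps)
      then show "4 * ((of_int a * (cmod z)\<^sup>2) * (of_int c * (cmod w)\<^sup>2)) \<le>
          (of_int a * (cmod z)\<^sup>2 + of_int c * (cmod w)\<^sup>2)\<^sup>2" .
    qed simp
    also have "\<dots> = (r * Im \<kappa>)\<^sup>2" unfolding q0 by (simp add: power_mult_distrib)
    finally have "4 * h\<^sup>2 * of_int a * of_int c * r\<^sup>2 \<le> (Im \<kappa>)\<^sup>2 * r\<^sup>2"
      by (simp add: power_mult_distrib mult.commute)
    then show ?thesis using False by (simp add: mult_le_cancel_right)
  qed
  with det have "(Re \<kappa>)\<^sup>2 \<le> 1" by simp
  then have abs: "\<bar>Re \<kappa>\<bar> \<le> 1" by (simp add: abs_square_le_1)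
  have "k = 0"
  proof (rule ccontr)
    assume "k \<noteq> 0"
    then have "1 \<le> \<bar>real_of_int k\<bar>" by linarith
    then have "(15 / 4) * 1 \<le> h\<^sup>2 * \<bar>real_of_int k\<bar>" using h_large by (intro mult_mono) auto
    then have "15 / 4 \<le> \<bar>h\<^sup>2 * of_int k\<bar>" by (simp add: abs_mult)
    with abs Re\<kappa> e(2) show False by (auto simp: abs_if split: if_splits)
  qed
  then have "y \<in> \<int>" using real_closed[OF yR] k by simp
  then obtain j :: int where j: "y = of_int j" by (elim Ints_cases)
  have \<kappa>': "Re \<kappa> = of_int e" "Im \<kappa> = - 2 * h * of_int j"
    using Re\<kappa> Im\<kappa> \<open>k = 0\<close> j by simp_all
  have "(real_of_int e)\<^sup>2 = 1" using e(2) by auto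
  with det have "h\<^sup>2 * (of_int j * of_int j) = h\<^sup>2 * (of_int a * real_of_int c)"
    unfolding \<kappa>' by (simp add: power_mult_distrib power2_eq_square)
  then have "real_of_int (j * j) = real_of_int (a * c)" using h_pos by simp
  \<comment> \<open>On real vectors \<open>Q\<close> is
    \<open>2 h (- a x^2 + 2 j x y - c y^2)\<close>, hence the signs.\<close>
  then have "j * j = (- a) * (- c)" by (simp only: of_int_eq_iff minus_mult_minus)
  then obtain l s t p q where l: "- a = l * (s * s)" "- c = l * (t * t)" "j = l * (s * t)"
      "p * t - q * s = 1"
    using int_square_eq_mult by blast
  have la: "real_of_int a = - real_of_int l * (of_int s * of_int s)"
      "real_of_int c = - real_of_int l * (of_int t * of_int t)"
    using arg_cong[OF l(1), of real_of_int] arg_cong[OF l(2), of real_of_int] by simp_all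
  have "Q (z, w) = 2 * h * of_int l * (cmod (snd (int_lin p q s t (z, w))))\<^sup>2
       - 2 * of_int e * Im (z * cnj w)" for z w
  proof -
    have "Im (z * cnj w * \<kappa>) = Re (z * cnj w) * Im \<kappa> + Im (z * cnj w) * Re \<kappa>"
      by (rule times_complex.simps(2)[THEN trans]) simp
    then have "Q (z, w) = 2 * h * of_int l * ((of_int s * of_int s) * (cmod z)\<^sup>2 +
        (of_int t * of_int t) * (cmod w)\<^sup>2 + 2 * (of_int s * of_int t) * Re (z * cnj w))
        - 2 * of_int e * Im (z * cnj w)"
      unfolding Qv la \<kappa>' l(3) by (simp add: algebra_simps)
    also have "(of_int s * of_int s) * (cmod z)\<^sup>2 +
        (of_int t * of_int t) * (cmod w)\<^sup>2 + 2 * (of_int s * of_int t) * Re (z * cnj w) =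
        (cmod (of_int s * z + of_int t * w))\<^sup>2"
      by (simp add: cmod_power2) (simp add: algebra_simps power2_eq_square)
    finally show ?thesis by simp
  qed
  then show ?thesis using l(4) e(2) by blast
qed

text \<open>In the coordinate given by \<open>N\<close> the tangency point is infinity and
  \<open>Q\<close> is a horizontal line: for \<open>e = 1\<close> its interior
  \<open>Im z > h k\<close> meets the upper half-plane, for \<open>e = -1\<close> it is
  \<open>Im z < - h k\<close>. Then \<open>k < 0\<close> makes interiors overlap,
  \<open>k = 0\<close> is the reversed real line, and for \<open>k \<ge> 2\<close> the line at
  height \<open>- h\<close> is straddled.\<close>

lemma real_form_neighbour:
  assumes adj: "adjacent_forms R real_form Q"
  shows "\<exists>p q s t :: int. p * t - q * s = 1 \<and> Q = low_form \<circ> int_lin p q s t"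
proof -
  obtain p q s t k e :: int where det: "p * t - q * s = 1" and e: "e = 1 \<or> e = -1"
    and Q: "\<And>z w. Q (z, w) = 2 * h * of_int k * (cmod (snd (int_lin p q s t (z, w))))\<^sup>2
       - 2 * of_int e * Im (z * cnj w)"
    using real_form_neighbour_shape[OF adj] by blast
  define N where "N = int_lin p q s t"
  define M where "M = int_lin t (- q) (- s) p"
  have NM: "N (M v) = v" for v unfolding N_def M_def using det by (rule int_lin_inverse)
  have Q': "Q v = 2 * h * of_int k * (cmod (snd (N v)))\<^sup>2 + of_int e * real_form (N v)" for v
  proof -
    obtain z w where v: "v = (z, w)" by (cases v)
    have rf: "real_form (N v) = - 2 * Im (z * cnj w)"
      unfolding N_def v real_form_int_lin[OF det] by simp
    show ?thesis unfolding rf unfolding v Q N_def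
      by (simp only: ac_simps mult_minus_left mult_minus_right diff_conv_add_uminus)
  qed
  have QM: "Q (M (z, w)) = 2 * h * of_int k * (cmod w)\<^sup>2 - 2 * of_int e * Im (z * cnj w)" for z w
    unfolding Q' NM real_form_apply snd_conv by algebra
  have rM: "real_form (M v) = real_form v" for v
    using real_form_int_lin[OF det, of "M v"] NM[of v] by (simp add: N_def)
  have disj: "\<not> (real_form (M v) < 0 \<and> Q (M v) < 0)" for v
    using adj unfolding adjacent_forms_def by blast
  have "e \<noteq> 1"
  proof
    assume "e = 1"
    \<comment> \<open>The test point lies above both the real line and the line at height
      \<open>h k\<close>.\<close>
    have "h * of_int k \<le> \<bar>h * of_int k\<bar>" by simp
    moreover have "real_form (M (\<i> * of_real (\<bar>h * of_int k\<bar> + 1), 1)) < 0"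
      unfolding rM by simp
    ultimately show False
      using disj[of "(\<i> * of_real (\<bar>h * of_int k\<bar> + 1), 1)"] \<open>e = 1\<close> unfolding QM by simp
  qed
  with e have e: "e = -1" by simp
  have "k \<ge> 0"
  proof (rule ccontr)
    assume "\<not> k \<ge> 0"
    then have "h * of_int k < 0" using h_pos by (simp add: mult_pos_neg)
    \<comment> \<open>The test point is halfway up the strip between the heights 0 and
      \<open>- h k\<close>.\<close>
    moreover from this have "real_form (M (\<i> * of_real (- h * of_int k / 2), 1)) < 0"
      unfolding rM by simp
    ultimately show False
      using disj[of "(\<i> * of_real (- h * of_int k / 2), 1)"] e unfolding QM by simp
  qed
  moreover have "k \<noteq> 0"
  proof
    assume "k = 0"
    then have "Q v = - real_form v" for v
      using Q' e real_form_int_lin[OF det, of v] by (simp add: N_def)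
    then show False using adj unfolding adjacent_forms_def by force
  qed
  moreover have "k \<le> 1"
  proof (rule ccontr)
    assume k: "\<not> k \<le> 1"
    \<comment> \<open>the immediate neighbour at the same tangency point separates the two circles\<close>
    define B where "B = low_form \<circ> N"
    have "B \<in> bianchi_forms R"
      unfolding B_def N_def using low_form_bianchi int_lin_unimodular[OF det] by (rule bianchi_forms_comp)
    moreover have "Q (M (- \<i> * of_real (h * of_int k), 1)) = 0" unfolding QM e by simp
    moreover have "B (M (- \<i> * of_real (h * of_int k), 1)) < 0"
      using k h_pos unfolding B_def comp_apply NM by (simp add: low_form_def)
    moreover have "real_form (M (0, 1)) = 0" unfolding rM by simp
    moreover have "B (M (0, 1)) > 0"
      using h_pos unfolding B_def comp_apply NM by (simp add: low_form_def)
    ultimately show False using adj unfolding adjacent_forms_def by blast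
  qed
  ultimately have "k = 1" by simp
  have "Q = low_form \<circ> N"
  proof
    fix v
    show "Q v = (low_form \<circ> N) v"
      unfolding Q' \<open>k = 1\<close> e comp_apply by (cases "N v") (simp add: low_form_def)
  qed
  then show ?thesis using det unfolding N_def by blast
qed

text \<open>Induction on the length, with the path re-rooted at \<open>Q\<close>. The tail places
  \<open>swap (N v)\<close> near an integer, so \<open>N v\<close> is far from all integers, and
  \<open>M\<close>, which moves infinity, brings it back near one.\<close>

lemma nonbacktracking_path_near_integers:
  assumes "nonbacktracking (adjacent_forms R) (real_form # Q # Qs)" and "Q \<noteq> low_form"
    and "last (Q # Qs) v = 0"
  shows "near_integer v"
  using assms
proof (induction "length Qs" arbitrary: Q Qs v rule: less_induct)
  case less
  have adj: "adjacent_forms R real_form Q" using less.prems(1) by (cases Qs) auto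
  obtain p q s t :: int where det: "p * t - q * s = 1" and Q: "Q = low_form \<circ> int_lin p q s t"
    using real_form_neighbour[OF adj] by blast
  define N where "N = int_lin p q s t"
  define M where "M = int_lin t (- q) (- s) p"
  have NM: "N (M v) = v" and MN: "M (N v) = v" for v
    unfolding N_def M_def using int_lin_inverse[OF det] by blast+
  have detM: "t * p - (- q) * (- s) = 1" using det by (simp add: algebra_simps)
  \<comment> \<open>For \<open>s = 0\<close> the matrix is a translation up to sign, which preserves
    \<open>low_form\<close>.\<close>
  have "s \<noteq> 0"
  proof
    assume "s = 0"
    then have pt: "p * t = 1" using det by simp
    then have t: "\<bar>t\<bar> = 1" by (auto simp: zmult_eq_1_iff)
    have "Q (z, w) = low_form (z, w)" for z w
    proof -
      have "cmod (of_int t * w) = cmod w" using t by (simp add: norm_mult flip: of_int_abs)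
      then show ?thesis using Im_modular[OF det, of z w] \<open>s = 0\<close> by (simp add: Q low_form_def)
    qed
    then show False using less.prems(2) by auto
  qed
  have "far_from_integers (N v)"
  proof (cases Qs)
    case Nil
    then show ?thesis using less.prems(3) by (intro far_if_low_form_zero) (simp add: Q N_def)
  next
    case (Cons E Es)
    \<comment> \<open>Precomposition with \<open>f\<close> turns \<open>Q\<close> into
      \<open>real_form\<close> and \<open>real_form\<close> into \<open>low_form\<close>; thus
      \<open>E \<noteq> real_form\<close> becomes the hypothesis
      \<open>E \<circ> f \<noteq> low_form\<close> of the induction.\<close>
    define f where "f = M \<circ> swap"
    have f: "f \<in> unimodular R"
      unfolding f_def M_def using int_lin_unimodular[OF detM] swap_unimodular by (rule unimodular_comp)
    have inj: "inj (\<lambda>P. P \<circ> f)" using f by (intro inj_comp_right unimodular_surj)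
    have "nonbacktracking (adjacent_forms R) (map (\<lambda>P. P \<circ> f) (Q # E # Es))"
      using less.prems(1) inj f by (intro nonbacktracking_map adjacent_forms_comp) (auto simp: Cons)
    moreover have "Q \<circ> f = real_form"
      unfolding low_form_swap[symmetric] by (simp add: fun_eq_iff Q f_def NM flip: N_def)
    ultimately have "nonbacktracking (adjacent_forms R)
        (real_form # (E \<circ> f) # map (\<lambda>P. P \<circ> f) Es)" by simp
    moreover have "real_form \<circ> f = low_form"
      using real_form_int_lin[OF detM]
      unfolding real_form_swap[symmetric] by (simp add: fun_eq_iff f_def M_def)
    moreover have "E \<noteq> real_form" using less.prems(1) by (auto simp: Cons)
    ultimately have "E \<circ> f \<noteq> low_form" using inj by (metis injD)
    have "last (map (\<lambda>P. P \<circ> f) (E # Es)) = last (E # Es) \<circ> f" by (rule last_map) simp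
    then have "last ((E \<circ> f) # map (\<lambda>P. P \<circ> f) Es) (swap (N v)) = 0"
      using less.prems(3) by (simp add: Cons f_def swap_swap MN)
    with \<open>nonbacktracking (adjacent_forms R) (real_form # (E \<circ> f) # map (\<lambda>P. P \<circ> f) Es)\<close>
      \<open>E \<circ> f \<noteq> low_form\<close> have "near_integer (swap (N v))"
      by (intro less.hyps[of "map (\<lambda>P. P \<circ> f) Es" "E \<circ> f"]) (auto simp: Cons)
    then show ?thesis by (rule far_if_near_swap)
  qed
  then have "near_integer (M (N v))"
    unfolding M_def using detM \<open>s \<noteq> 0\<close> by (intro near_integer_modular) auto
  then show ?case by (simp add: MN)
qed

text \<open>The symmetries act transitively on pairs of neighbours, so the closing edge can be moved
  to the pair \<open>low_form\<close>, \<open>real_form\<close>. As the cycle has at least three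
  vertices, its second vertex is not the last one, and the path argument applies.\<close>

lemma no_cycle_of_forms:
  assumes "distinct Ps" "3 \<le> length Ps" "successively (adjacent_forms R) Ps"
    and closing: "adjacent_forms R (last Ps) (hd Ps)"
  shows False
proof -
  obtain P Q Qs where Ps: "Ps = P # Q # Qs" "Qs \<noteq> []"
    using assms(2) by (cases Ps rule: remdups_adj.cases) fastforce+
  have "P \<in> bianchi_forms R" using closing by (simp add: adjacent_forms_def Ps)
  then obtain f where f: "f \<in> unimodular R" "P = real_form \<circ> f" by (auto simp: bianchi_forms_def)
  obtain g where g: "g \<in> unimodular R" "f \<circ> g = id" using f(1) by (rule unimodular_inverse)
  have Pg: "P \<circ> g = real_form" by (simp add: f comp_assoc g)
  have "adjacent_forms R real_form (last Ps \<circ> g)"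
    using adjacent_forms_comp[OF adjacent_forms_sym[OF closing] g(1)] by (simp add: Ps Pg)
  then obtain p q s t :: int where det: "p * t - q * s = 1"
    and last: "last Ps \<circ> g = low_form \<circ> int_lin p q s t"
    using real_form_neighbour by blast
  define M where "M = int_lin t (- q) (- s) p"
  have detM: "t * p - (- q) * (- s) = 1" using det by (simp add: algebra_simps)
  define T where "T = (\<lambda>X. X \<circ> (g \<circ> M) :: complex \<times> complex \<Rightarrow> real)"
  have gM: "g \<circ> M \<in> unimodular R"
    unfolding M_def using g(1) int_lin_unimodular[OF detM] by (rule unimodular_comp)
  have inj: "inj T" unfolding T_def using gM by (intro inj_comp_right unimodular_surj)
  have TP: "T P = real_form"
    using real_form_int_lin[OF detM] unfolding T_def comp_assoc[symmetric] Pg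
    by (simp add: fun_eq_iff M_def)
  have Tlast: "T (last Ps) = low_form"
    unfolding T_def comp_assoc[symmetric] last M_def
    using int_lin_inverse(1)[OF det] by (simp add: fun_eq_iff)
  have "nonbacktracking (adjacent_forms R) (map T Ps)"
  proof (rule nonbacktracking_map[OF _ _ inj])
    show "nonbacktracking (adjacent_forms R) Ps"
      using assms by (intro nonbacktracking_if_distinct)
  qed (unfold T_def, rule adjacent_forms_comp[OF _ gM])
  then have "nonbacktracking (adjacent_forms R) (real_form # T Q # map T Qs)"
    by (simp add: Ps TP)
  moreover have "Q \<noteq> last Ps" using assms(1) by (auto simp: Ps)
  then have "T Q \<noteq> low_form" using inj Tlast by (metis injD)
  moreover have "last (map T (Q # Qs)) = T (last Ps)" by (subst last_map) (simp_all add: Ps)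
  \<comment> \<open>Infinity lies on the lower line but in none of the discs.\<close>
  then have "last (T Q # map T Qs) (1, 0) = 0" by (simp add: Tlast low_form_def)
  ultimately have "near_integer (1, 0)" by (rule nonbacktracking_path_near_integers)
  then show False by (simp add: near_integer_def)
qed

end

section \<open>Oriented circles as Hermitian forms\<close>

text \<open>The division by \<open>r\<close> and the factor 2 normalise the determinant to -1, so
  that an oriented circle has exactly one form.\<close>

fun circle_form :: "oriented_circle \<Rightarrow> complex \<times> complex \<Rightarrow> real" where
  "circle_form (CCW c r) = (\<lambda>(z, w). ((cmod (z - c * w))\<^sup>2 - r\<^sup>2 * (cmod w)\<^sup>2) / r)"
| "circle_form (CW c r) = (\<lambda>(z, w). - (((cmod (z - c * w))\<^sup>2 - r\<^sup>2 * (cmod w)\<^sup>2) / r))"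
| "circle_form (Line u d) = (\<lambda>(z, w). 2 * (d * (cmod w)\<^sup>2 - Im (z * cnj w / u)))"

fun homogeneous :: "riemann_sphere \<Rightarrow> complex \<times> complex" where
  "homogeneous None = (1, 0)"
| "homogeneous (Some z) = (z, 1)"

definition scale :: "complex \<Rightarrow> complex \<times> complex \<Rightarrow> complex \<times> complex" where
  "scale l = (\<lambda>(z, w). (l * z, l * w))"

lemma scale_apply [simp]: "scale l (z, w) = (l * z, l * w)"
  by (simp add: scale_def)

lemma scale_scale: "scale l (scale m v) = scale (l * m) v"
  by (cases v) simp

lemma lin_scale: "lin a b c d (scale l v) = scale l (lin a b c d v)"
  by (cases v) (simp add: algebra_simps)

lemma homogeneous_nonzero: "homogeneous p \<noteq> 0"
  by (cases p) (auto simp: zero_prod_def)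

lemma homogeneous_coordinates:
  assumes "v \<noteq> 0"
  obtains l p where "l \<noteq> 0" "v = scale l (homogeneous p)"
proof -
  obtain z w where v: "v = (z, w)" by (cases v)
  show thesis
  proof (cases "w = 0")
    case True
    then show thesis using that[of z None] assms by (simp add: v zero_prod_def)
  next
    case False
    then show thesis using that[of w "Some (z / w)"] by (simp add: v)
  qed
qed

lemma homogeneous_scale_inj: "homogeneous p = scale l (homogeneous q) \<Longrightarrow> p = q"
  by (cases p; cases q) auto

lemma real_form_scale: "real_form (scale l v) = (cmod l)\<^sup>2 * real_form v"
proof -
  obtain z w where v: "v = (z, w)" by (cases v)
  have "l * z * cnj (l * w) = (l * cnj l) * (z * cnj w)" by simp
  then have "Im (l * z * cnj (l * w)) = Im (of_real ((cmod l)\<^sup>2) * (z * cnj w))"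
    by (simp only: complex_norm_square)
  also have "\<dots> = (cmod l)\<^sup>2 * Im (z * cnj w)" by (simp add: algebra_simps)
  finally have im: "Im (l * z * cnj (l * w)) = (cmod l)\<^sup>2 * Im (z * cnj w)" .
  show ?thesis unfolding v scale_apply real_form_apply im by (rule mult.left_commute)
qed

lemma circle_form_scale: "circle_form C (scale l v) = (cmod l)\<^sup>2 * circle_form C v"
proof -
  obtain z w where v: "v = (z, w)" by (cases v)
  have 1: "(cmod (l * z - c * (l * w)))\<^sup>2 = (cmod l)\<^sup>2 * (cmod (z - c * w))\<^sup>2" for c
  proof -
    have "l * z - c * (l * w) = l * (z - c * w)" by (simp add: algebra_simps)
    then show ?thesis by (simp add: norm_mult power_mult_distrib)
  qed
  have 2: "Im (l * z * cnj (l * w) / u) = (cmod l)\<^sup>2 * Im (z * cnj w / u)" for u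
  proof -
    have "l * z * cnj (l * w) / u = (l * cnj l) * (z * cnj w / u)" by simp
    then have "Im (l * z * cnj (l * w) / u) = Im (of_real ((cmod l)\<^sup>2) * (z * cnj w / u))"
      by (simp only: complex_norm_square)
    then show ?thesis by (simp only: times_complex.sel Re_complex_of_real Im_complex_of_real)
  qed
  show ?thesis unfolding v scale_apply
    by (cases C) (simp_all only: circle_form.simps prod.case 1 2 norm_mult power_mult_distrib,
      simp_all add: field_simps)
qed

lemma circle_form_zero_vector: "circle_form C 0 = 0"
  by (cases C) (auto simp: zero_prod_def)

lemma underlying_circle_iff:
  "is_oriented_circle C \<Longrightarrow> p \<in> underlying_circle C \<longleftrightarrow> circle_form C (homogeneous p) = 0"
  by (cases C; cases p)
    (auto simp: dist_norm norm_minus_commute power2_eq_iff_nonneg less_imp_le image_iff)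

lemma circle_interior_iff:
  assumes "is_oriented_circle C"
  shows "p \<in> circle_interior C \<longleftrightarrow> circle_form C (homogeneous p) < 0"
proof -
  have "(x\<^sup>2 - r\<^sup>2) / r < 0 \<longleftrightarrow> x < r" "0 < (x\<^sup>2 - r\<^sup>2) / r \<longleftrightarrow> r < x" if "x \<ge> 0" "r > 0" for x r :: real
  proof -
    have "x\<^sup>2 < r\<^sup>2 \<longleftrightarrow> x < r" "r\<^sup>2 < x\<^sup>2 \<longleftrightarrow> r < x"
      using that power_mono_iff[of r x 2] power_mono_iff[of x r 2] by (simp_all flip: not_le)
    then show "(x\<^sup>2 - r\<^sup>2) / r < 0 \<longleftrightarrow> x < r" "0 < (x\<^sup>2 - r\<^sup>2) / r \<longleftrightarrow> r < x"
      using that by (simp_all add: divide_less_0_iff zero_less_divide_iff)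
  qed
  then show ?thesis using assms
    by (cases C; cases p) (auto simp: dist_norm norm_minus_commute image_iff)
qed

lemma circle_exterior_iff:
  "is_oriented_circle C \<Longrightarrow> p \<in> circle_exterior C \<longleftrightarrow> circle_form C (homogeneous p) > 0"
  unfolding circle_exterior_def using underlying_circle_iff[of C p] circle_interior_iff[of C p]
  by (auto simp: less_le not_less)

text \<open>Rules out that a circle is tangent to itself or to its reversal.\<close>

lemma underlying_circle_not_singleton:
  assumes "is_oriented_circle C"
  shows "\<not> is_singleton (underlying_circle C)"
proof -
  have "\<exists>p \<in> underlying_circle C. \<exists>q \<in> underlying_circle C. p \<noteq> q"
  proof (cases C)
    case (CCW c r)
    then show ?thesis using assms
      by (intro bexI[of _ "Some (c + of_real r)"] bexI[of _ "Some (c - of_real r)"]) (auto simp: dist_norm)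
  next
    case (CW c r)
    then show ?thesis using assms
      by (intro bexI[of _ "Some (c + of_real r)"] bexI[of _ "Some (c - of_real r)"]) (auto simp: dist_norm)
  next
    case (Line u d)
    then have "u \<noteq> 0" using assms by auto
    then show ?thesis using Line
      by (intro bexI[of _ None] bexI[of _ "Some (\<i> * of_real d * u)"]) auto
  qed
  then show ?thesis by (auto simp: is_singleton_def)
qed

text \<open>Comparing the distances of the opposite points \<open>c \<plusminus> r\<close> and
  \<open>c \<plusminus> \<i> r\<close> from \<open>c'\<close> shows that both coordinates of
  \<open>c - c'\<close> vanish.\<close>

lemma sphere_inj:
  fixes c c' :: complex
  assumes "sphere c r = sphere c' r'" "r > 0" "r' > 0"
  shows "c = c'" "r = r'"
proof -
  define x where "x = c - c'"
  have *: "(cmod (x + of_real r * u))\<^sup>2 = r'\<^sup>2" if "cmod u = 1" for u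
  proof -
    have "c + of_real r * u \<in> sphere c r" using assms(2) that by (simp add: dist_norm norm_mult)
    then have "dist (c + of_real r * u) c' = r'" unfolding assms(1) by (simp add: dist_commute)
    moreover have "c + of_real r * u - c' = x + of_real r * u" by (simp add: x_def)
    ultimately show ?thesis by (simp add: dist_norm)
  qed
  have sq: "(a + r)\<^sup>2 - (a - r)\<^sup>2 = 4 * (r * a)" for a :: real
    by (simp add: power2_eq_square algebra_simps)
  have "(Re x + r)\<^sup>2 + (Im x)\<^sup>2 = r'\<^sup>2" "(Re x - r)\<^sup>2 + (Im x)\<^sup>2 = r'\<^sup>2"
      "(Re x)\<^sup>2 + (Im x + r)\<^sup>2 = r'\<^sup>2" "(Re x)\<^sup>2 + (Im x - r)\<^sup>2 = r'\<^sup>2"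
    using *[of 1] *[of "-1"] *[of \<i>] *[of "-\<i>"] by (simp_all add: cmod_power2)
  then have "4 * (r * Re x) = 0" "4 * (r * Im x) = 0"
    using sq[of "Re x"] sq[of "Im x"] by linarith+
  then have x: "x = 0" using assms(2) by (simp add: complex_eq_iff)
  then show "c = c'" by (simp add: x_def)
  show "r = r'" using *[of 1] x assms(2,3) by (simp add: power2_eq_iff_nonneg)
qed

text \<open>Two points of the line that differ by \<open>u\<close> show that \<open>u / u'\<close>
  is real; having modulus 1, it is 1 or -1.\<close>

lemma line_inj:
  assumes eq: "{z. Im (z / u) = d} = {z. Im (z / u') = d'}" and u: "cmod u = 1" "cmod u' = 1"
  shows "u = u' \<and> d = d' \<or> u = - u' \<and> d = - d'"
proof -
  have nz: "u \<noteq> 0" "u' \<noteq> 0" using u by auto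
  have *: "Im (z / u') = d'" if "Im (z / u) = d" for z using eq that by blast
  have 1: "Im ((\<i> * of_real d * u) / u') = d'" using nz by (intro *) simp
  have 2: "Im ((\<i> * of_real d * u + u) / u') = d'" using nz by (intro *) (simp add: add_divide_distrib)
  have im: "Im (u / u') = 0" using 1 2 by (simp add: add_divide_distrib)
  have "cmod (u / u') = 1" using u by (simp add: norm_divide)
  then have "u / u' = 1 \<or> u / u' = -1"
    using im by (auto simp: complex_eq_iff cmod_def)
  then have "u = u' \<or> u = - u'" using nz by (auto simp: field_simps)
  then show ?thesis using 1 nz by auto
qed

lemma underlying_circle_eq_imp:
  assumes "is_oriented_circle C" "is_oriented_circle D"
    and eq: "underlying_circle C = underlying_circle D"
  shows "circle_form C = circle_form D \<or> circle_form C = (\<lambda>v. - circle_form D v)"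
proof -
  have inf: "None \<in> underlying_circle X \<longleftrightarrow> (\<exists>u d. X = Line u d)" for X by (cases X) auto
  have S: "Some ` A = Some ` B \<Longrightarrow> A = B" for A B :: "complex set" by (simp add: inj_image_eq_iff)
  show ?thesis
  proof (cases "\<exists>u d. C = Line u d")
    case True
    then obtain u d u' d' where CD: "C = Line u d" "D = Line u' d'" using inf eq by metis
    have "insert None (Some ` {z. Im (z / u) = d}) - {None} =
        insert None (Some ` {z. Im (z / u') = d'}) - {None}" using eq CD by simp
    moreover have "insert None (Some ` A) - {None} = Some ` A" for A :: "complex set" by auto
    ultimately have "{z. Im (z / u) = d} = {z. Im (z / u') = d'}" using S by metis
    from line_inj[OF this] assms(1,2) CD have "u = u' \<and> d = d' \<or> u = - u' \<and> d = - d'" by simp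
    then show ?thesis unfolding CD by (elim disjE conjE) (simp_all add: fun_eq_iff algebra_simps)
  next
    case False
    then have nD: "\<nexists>u d. D = Line u d" using inf eq by metis
    \<comment> \<open>Centre and radius irrespective of orientation; the value on
      \<open>Line\<close> is a dummy.\<close>
    define sph where "sph X = (case X of CCW c r \<Rightarrow> (c, r) | CW c r \<Rightarrow> (c, r) | Line c r \<Rightarrow> (c, r))" for X
    have "underlying_circle X = Some ` sphere (fst (sph X)) (snd (sph X)) \<and> snd (sph X) > 0"
      if "\<nexists>u d. X = Line u d" "is_oriented_circle X" for X
      using that by (cases X) (auto simp: sph_def)
    then have C: "underlying_circle C = Some ` sphere (fst (sph C)) (snd (sph C))" "snd (sph C) > 0"
      and D: "underlying_circle D = Some ` sphere (fst (sph D)) (snd (sph D))" "snd (sph D) > 0"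
      using False nD assms by blast+
    have "sph C = sph D"
      using sphere_inj[OF S C(2) D(2)] eq C(1) D(1) by (simp add: prod_eq_iff)
    then show ?thesis using False nD
      by (cases C; cases D) (auto simp: sph_def fun_eq_iff)
  qed
qed

text \<open>The value at \<open>(1, 0)\<close> is \<open>1 / r\<close>, \<open>- 1 / r\<close> or 0,
  which tells the constructors apart and gives the radius.\<close>

lemma circle_form_inj:
  assumes "is_oriented_circle C" "is_oriented_circle D" "circle_form C = circle_form D"
  shows "C = D"
proof -
  have val: "circle_form C v = circle_form D v" for v using assms(3) by simp
  show ?thesis
  proof (cases C; cases D)
    fix c r c' r' assume CD: "C = CCW c r" "D = CCW c' r'"
    with val[of "(1, 0)"] assms have "r = r'" by simp
    with val[of "(c, 1)"] assms CD show "C = D" by (simp add: diff_divide_distrib)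
  next
    fix c r c' r' assume CD: "C = CW c r" "D = CW c' r'"
    with val[of "(1, 0)"] assms have "r = r'" by simp
    with val[of "(c, 1)"] assms CD show "C = D" by (simp add: diff_divide_distrib)
  next
    fix u d u' d' assume CD: "C = Line u d" "D = Line u' d'"
    with val[of "(0, 1)"] have d: "d = d'" by simp
    have "Im (1 / u) = Im (1 / u')" "Im (\<i> / u) = Im (\<i> / u')"
      using val[of "(1, 1)"] val[of "(\<i>, 1)"] CD d by simp_all
    then have "1 / u = 1 / u'" by (simp add: complex_eq_iff Re_divide Im_divide)
    with d CD show "C = D" by simp
  qed (use val[of "(1, 0)"] assms in \<open>auto simp: field_simps\<close>)
qed

text \<open>Completing the square gives centre \<open>\<i> * cnj \<kappa> / A\<close>, and
  determinant -1 makes the radius \<open>1 / \<bar>A\<bar>\<close>; the sign of \<open>A\<close> is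
  the orientation. For \<open>A = 0\<close> the form is a line.\<close>

lemma hermitian_form_circle:
  fixes A B :: real and \<kappa> :: complex
  assumes det: "(cmod \<kappa>)\<^sup>2 - A * B = 1"
  obtains C where "is_oriented_circle C"
    "\<And>z w. circle_form C (z, w) = A * (cmod z)\<^sup>2 + B * (cmod w)\<^sup>2 - 2 * Im (z * cnj w * \<kappa>)"
proof -
  have key: "(cmod (z - \<i> * cnj \<kappa> / of_real A * w))\<^sup>2 * A - (cmod w)\<^sup>2 / A =
      A * (cmod z)\<^sup>2 + B * (cmod w)\<^sup>2 - 2 * Im (z * cnj w * \<kappa>)" if "A \<noteq> 0" for z w
  proof -
    have "A * ((cmod (z - \<i> * cnj \<kappa> / of_real A * w))\<^sup>2 * A - (cmod w)\<^sup>2 / A) =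
        (cmod (of_real A * z - \<i> * cnj \<kappa> * w))\<^sup>2 - (cmod w)\<^sup>2"
    proof -
      have "of_real A * z - \<i> * cnj \<kappa> * w = of_real A * (z - \<i> * cnj \<kappa> / of_real A * w)"
        using that by (simp add: field_simps)
      then have "(cmod (of_real A * z - \<i> * cnj \<kappa> * w))\<^sup>2 =
          A\<^sup>2 * (cmod (z - \<i> * cnj \<kappa> / of_real A * w))\<^sup>2"
        by (simp add: norm_mult power_mult_distrib)
      then show ?thesis using that by (simp add: field_simps power2_eq_square)
    qed
    also have "\<dots> = A\<^sup>2 * (cmod z)\<^sup>2 + ((cmod \<kappa>)\<^sup>2 - 1) * (cmod w)\<^sup>2 - A * (2 * Im (z * cnj w * \<kappa>))"
      by (simp add: cmod_power2) (simp add: algebra_simps power2_eq_square)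
    also have "(cmod \<kappa>)\<^sup>2 - 1 = A * B" using det by simp
    finally have "A * ((cmod (z - \<i> * cnj \<kappa> / of_real A * w))\<^sup>2 * A - (cmod w)\<^sup>2 / A) =
        A * (A * (cmod z)\<^sup>2 + B * (cmod w)\<^sup>2 - 2 * Im (z * cnj w * \<kappa>))"
      by (simp add: algebra_simps power2_eq_square)
    then show ?thesis using that by (simp only: mult_cancel_left) simp
  qed
  consider "A > 0" | "A < 0" | "A = 0" by linarith
  then show thesis
  proof cases
    case 1
    show thesis
    proof (rule that[of "CCW (\<i> * cnj \<kappa> / of_real A) (1 / A)"])
      fix z w
      show "circle_form (CCW (\<i> * cnj \<kappa> / of_real A) (1 / A)) (z, w) =
          A * (cmod z)\<^sup>2 + B * (cmod w)\<^sup>2 - 2 * Im (z * cnj w * \<kappa>)"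
        using key[of z w] 1 by (simp add: algebra_simps power2_eq_square)
    qed (use 1 in simp)
  next
    case 2
    show thesis
    proof (rule that[of "CW (\<i> * cnj \<kappa> / of_real A) (- 1 / A)"])
      fix z w
      show "circle_form (CW (\<i> * cnj \<kappa> / of_real A) (- 1 / A)) (z, w) =
          A * (cmod z)\<^sup>2 + B * (cmod w)\<^sup>2 - 2 * Im (z * cnj w * \<kappa>)"
        using key[of z w] 2 by (simp add: algebra_simps power2_eq_square)
    qed (use 2 in \<open>simp add: divide_less_0_iff\<close>)
  next
    case 3
    have k: "cmod \<kappa> = 1" using det 3 power2_eq_imp_eq[of "cmod \<kappa>" 1] by simp
    then have "\<kappa> * cnj \<kappa> = 1" by (simp flip: complex_norm_square)
    then have inv: "x / cnj \<kappa> = x * \<kappa>" for x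
      by (metis mult.assoc mult.right_neutral mult_zero_right nonzero_divide_eq_eq zero_neq_one)
    show thesis
    proof (rule that[of "Line (cnj \<kappa>) (B / 2)"])
      fix z w
      show "circle_form (Line (cnj \<kappa>) (B / 2)) (z, w) =
          A * (cmod z)\<^sup>2 + B * (cmod w)\<^sup>2 - 2 * Im (z * cnj w * \<kappa>)"
        unfolding circle_form.simps prod.case inv using 3 by (simp add: algebra_simps)
    qed (use k in simp)
  qed
qed

section \<open>Moebius action and Bianchi circles\<close>

lemma homogeneous_mobius_action:
  assumes "a * d - b * c = 1" "M $ 1 $ 1 = a" "M $ 1 $ 2 = b" "M $ 2 $ 1 = c" "M $ 2 $ 2 = d"
  obtains l where "l \<noteq> 0" "lin a b c d (homogeneous p) = scale l (homogeneous (mobius_action M p))"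
proof (cases p)
  case None
  show thesis
  proof (cases "c = 0")
    case True
    then have "a \<noteq> 0" using assms(1) by auto
    then show thesis using that[of a] assms True by (auto simp: None mobius_action_def)
  next
    case False
    then show thesis using that[of c] assms by (auto simp: None mobius_action_def)
  qed
next
  case (Some z)
  show thesis
  proof (cases "c * z + d = 0")
    case True
    have "a * z + b \<noteq> 0"
    proof
      assume "a * z + b = 0"
      moreover have "c * (a * z + b) - a * (c * z + d) = - (a * d - b * c)" by (simp add: algebra_simps)
      ultimately show False using True assms(1) by simp
    qed
    then show thesis using that[of "a * z + b"] True assms by (auto simp: Some mobius_action_def)
  next
    case False
    then show thesis using that[of "c * z + d"] assms
      by (auto simp: Some mobius_action_def moebius_def)
  qed
qed

lemma extended_reals_iff: "p \<in> extended_reals \<longleftrightarrow> real_form (homogeneous p) = 0"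
proof (cases p)
  case (Some z)
  have "(\<exists>x::real. z = of_real x) \<longleftrightarrow> Im z = 0"
    by (metis Im_complex_of_real complex_is_Real_iff Reals_cases)
  then show ?thesis by (auto simp: extended_reals_def Some)
qed (simp add: extended_reals_def)

lemma mobius_image_extended_reals_iff:
  assumes M: "a * d - b * c = 1" "M $ 1 $ 1 = a" "M $ 1 $ 2 = b" "M $ 2 $ 1 = c" "M $ 2 $ 2 = d"
  shows "p \<in> mobius_action M ` extended_reals \<longleftrightarrow> real_form (lin d (- b) (- c) a (homogeneous p)) = 0"
proof -
  have inv: "lin d (- b) (- c) a (lin a b c d v) = v" "lin a b c d (lin d (- b) (- c) a v) = v" for v
  proof -
    obtain z w where v: "v = (z, w)" by (cases v)
    have "lin d (- b) (- c) a (lin a b c d v) = ((a * d - b * c) * z, (a * d - b * c) * w)"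
      "lin a b c d (lin d (- b) (- c) a v) = ((a * d - b * c) * z, (a * d - b * c) * w)"
      by (simp_all add: v algebra_simps)
    then show "lin d (- b) (- c) a (lin a b c d v) = v" "lin a b c d (lin d (- b) (- c) a v) = v"
      unfolding M(1) by (simp_all add: v)
  qed
  show ?thesis
  proof
    assume "p \<in> mobius_action M ` extended_reals"
    then obtain q where q: "q \<in> extended_reals" "p = mobius_action M q" by blast
    obtain l where l: "l \<noteq> 0" "lin a b c d (homogeneous q) = scale l (homogeneous p)"
      using homogeneous_mobius_action[OF M] q(2) by metis
    have "real_form (lin d (- b) (- c) a (scale l (homogeneous p))) = 0"
      unfolding l(2)[symmetric] inv using q(1) by (simp add: extended_reals_iff)
    then show "real_form (lin d (- b) (- c) a (homogeneous p)) = 0"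
      using l(1) by (simp add: lin_scale real_form_scale)
  next
    assume zero: "real_form (lin d (- b) (- c) a (homogeneous p)) = 0"
    define v where "v = lin d (- b) (- c) a (homogeneous p)"
    have lv: "lin a b c d v = homogeneous p" by (simp add: v_def inv)
    then have "v \<noteq> 0" using homogeneous_nonzero[of p] by (auto simp: zero_prod_def)
    then obtain l q where lq: "l \<noteq> 0" "v = scale l (homogeneous q)" by (rule homogeneous_coordinates)
    have "q \<in> extended_reals" using zero lq
      unfolding v_def[symmetric] by (simp add: real_form_scale extended_reals_iff)
    obtain m where m: "m \<noteq> 0" "lin a b c d (homogeneous q) = scale m (homogeneous (mobius_action M q))"
      using homogeneous_mobius_action[OF M] by metis
    have "homogeneous p = scale (l * m) (homogeneous (mobius_action M q))"
      using lv unfolding lq(2) lin_scale m(2) scale_scale by simp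
    then have "p = mobius_action M q" by (rule homogeneous_scale_inj)
    then show "p \<in> mobius_action M ` extended_reals" using \<open>q \<in> extended_reals\<close> by blast
  qed
qed

lemma SL2_iff: "M \<in> SL2 R \<longleftrightarrow> M $ 1 $ 1 \<in> R \<and> M $ 1 $ 2 \<in> R \<and> M $ 2 $ 1 \<in> R \<and> M $ 2 $ 2 \<in> R \<and>
    M $ 1 $ 1 * M $ 2 $ 2 - M $ 1 $ 2 * M $ 2 $ 1 = 1"
  by (auto simp: SL2_def det_2 forall_2)

context quadratic_order
begin

text \<open>Reversal of orientation comes from \<open>z \<mapsto> - z\<close>, of determinant -1,
  which negates \<open>real_form\<close>.\<close>

lemma bianchi_forms_uminus:
  assumes "P \<in> bianchi_forms R"
  shows "(\<lambda>v. - P v) \<in> bianchi_forms R"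
proof -
  obtain f where f: "f \<in> unimodular R" "P = real_form \<circ> f"
    using assms by (auto simp: bianchi_forms_def)
  have "lin (-1) 0 0 1 \<in> unimodular R"
    unfolding unimodular_def
    by (rule CollectI, intro exI conjI, rule refl) (auto intro: ring_closed)
  then have "lin (-1) 0 0 1 \<circ> f \<in> unimodular R" using f(1) by (rule unimodular_comp)
  moreover have "real_form (lin (-1) 0 0 1 v) = - real_form v" for v by (cases v) simp
  then have "(\<lambda>v. - P v) = real_form \<circ> (lin (-1) 0 0 1 \<circ> f)" by (simp add: f fun_eq_iff)
  ultimately show ?thesis by (auto simp: bianchi_forms_def)
qed

lemma bianchi_circle_zero_set:
  assumes "S = mobius_action M ` extended_reals" "M \<in> SL2 R"
  shows "\<exists>P \<in> bianchi_forms R. S = {p. P (homogeneous p) = 0}"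
proof -
  define a b c d where "a = M $ 1 $ 1" "b = M $ 1 $ 2" "c = M $ 2 $ 1" "d = M $ 2 $ 2"
  note abcd = this
  have det: "a * d - b * c = 1" and R: "a \<in> R" "b \<in> R" "c \<in> R" "d \<in> R"
    using assms(2) by (simp_all add: SL2_iff abcd)
  have "d * a - (- b) * (- c) = 1" using det by (simp add: algebra_simps)
  then have "lin d (- b) (- c) a \<in> unimodular R"
    unfolding unimodular_def using R ring_closed by blast
  then have "real_form \<circ> lin d (- b) (- c) a \<in> bianchi_forms R"
    by (simp add: bianchi_forms_def)
  moreover have "S = {p. (real_form \<circ> lin d (- b) (- c) a) (homogeneous p) = 0}"
    using mobius_image_extended_reals_iff[OF det, of M] assms(1) by (auto simp: abcd)
  ultimately show ?thesis by blast
qed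

lemma bianchi_form_zero_set:
  assumes "P \<in> bianchi_forms R"
  shows "\<exists>M \<in> SL2 R. {p. P (homogeneous p) = 0} = mobius_action M ` extended_reals"
proof -
  obtain \<alpha> \<beta> \<gamma> \<delta> where P: "P = real_form \<circ> lin \<alpha> \<beta> \<gamma> \<delta>"
    and R: "\<alpha> \<in> R" "\<beta> \<in> R" "\<gamma> \<in> R" "\<delta> \<in> R"
    and e: "\<alpha> * \<delta> - \<beta> * \<gamma> = 1 \<or> \<alpha> * \<delta> - \<beta> * \<gamma> = -1"
    using assms by (auto simp: bianchi_forms_def unimodular_def)
  define e where "e = \<alpha> * \<delta> - \<beta> * \<gamma>"
  have e1: "e = 1 \<or> e = -1" using e by (simp add: e_def)
  then have ee: "e * e = 1" and eR: "e \<in> R" using ring_closed by auto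
  \<comment> \<open>The inverse of the matrix whose first row has been multiplied by
    \<open>e\<close>: this makes the determinant 1 and changes \<open>P\<close> only by a
    sign.\<close>
  define M :: "complex^2^2" where "M = vector [vector [\<delta>, - (e * \<beta>)], vector [- \<gamma>, e * \<alpha>]]"
  have M: "M $ 1 $ 1 = \<delta>" "M $ 1 $ 2 = - (e * \<beta>)" "M $ 2 $ 1 = - \<gamma>" "M $ 2 $ 2 = e * \<alpha>"
    by (simp_all add: M_def vector_2)
  have det: "\<delta> * (e * \<alpha>) - (- (e * \<beta>)) * (- \<gamma>) = 1"
  proof -
    have "\<delta> * (e * \<alpha>) - (- (e * \<beta>)) * (- \<gamma>) = e * e" by (simp add: e_def algebra_simps)
    then show ?thesis by (simp add: ee)
  qed
  have "M \<in> SL2 R" unfolding SL2_iff M using R eR det by (auto intro: ring_closed)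
  moreover have "P (homogeneous p) = 0 \<longleftrightarrow>
      real_form (lin (e * \<alpha>) (- (- (e * \<beta>))) (- (- \<gamma>)) \<delta> (homogeneous p)) = 0" for p
    unfolding P using e1 by (cases "homogeneous p") (auto simp: algebra_simps)
  then have "{p. P (homogeneous p) = 0} = mobius_action M ` extended_reals"
    using mobius_image_extended_reals_iff[OF det M] by auto
  ultimately show ?thesis by blast
qed

lemma bianchi_form_circle:
  assumes "P \<in> bianchi_forms R"
  obtains C where "is_oriented_circle C" "circle_form C = P"
proof -
  obtain \<alpha> \<beta> \<gamma> \<delta> where P: "P = real_form \<circ> lin \<alpha> \<beta> \<gamma> \<delta>"
    and e: "\<alpha> * \<delta> - \<beta> * \<gamma> = 1 \<or> \<alpha> * \<delta> - \<beta> * \<gamma> = -1"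
    using assms by (auto simp: bianchi_forms_def unimodular_def)
  have "cmod (\<alpha> * \<delta> - \<beta> * \<gamma>) = 1" using e by auto
  then have "(cmod (\<alpha> * cnj \<delta> - cnj \<beta> * \<gamma>))\<^sup>2 -
      (- 2 * Im (\<alpha> * cnj \<gamma>)) * (- 2 * Im (\<beta> * cnj \<delta>)) = 1"
    using hermitian_determinant[of \<alpha> \<delta> \<beta> \<gamma>] by (simp add: algebra_simps)
  then obtain C where C: "is_oriented_circle C"
    "\<And>z w. circle_form C (z, w) = - 2 * Im (\<alpha> * cnj \<gamma>) * (cmod z)\<^sup>2 +
      - 2 * Im (\<beta> * cnj \<delta>) * (cmod w)\<^sup>2 - 2 * Im (z * cnj w * (\<alpha> * cnj \<delta> - cnj \<beta> * \<gamma>))"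
    by (rule hermitian_form_circle) blast
  have "circle_form C (z, w) = P (z, w)" for z w
    unfolding C(2) P comp_apply real_form_lin
    by (simp only: diff_conv_add_uminus mult_minus_left)
  then have "circle_form C = P" by auto
  with C(1) show thesis by (rule that)
qed

text \<open>The point set fixes the form only up to sign, and \<open>bianchi_forms\<close> is closed
  under negation.\<close>

lemma oriented_bianchi_circle_form:
  assumes R: "R = ring_of_integers K" and C: "C \<in> oriented_Bianchi_circles K"
  shows "circle_form C \<in> bianchi_forms R"
proof -
  have oC: "is_oriented_circle C" using C by (simp add: oriented_Bianchi_circles_def)
  obtain M where "M \<in> SL2 R" "underlying_circle C = mobius_action M ` extended_reals"
    using C by (auto simp: oriented_Bianchi_circles_def is_Bianchi_circle_def R)
  then obtain P where P: "P \<in> bianchi_forms R" "underlying_circle C = {p. P (homogeneous p) = 0}"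
    using bianchi_circle_zero_set by blast
  obtain D where D: "is_oriented_circle D" "circle_form D = P" using P(1) by (rule bianchi_form_circle)
  have "underlying_circle D = underlying_circle C"
    using underlying_circle_iff[OF D(1)] D(2) P(2) by auto
  then show ?thesis
    using underlying_circle_eq_imp[OF oC D(1)] D(2) P(1) bianchi_forms_uminus by auto
qed

lemma bianchi_form_oriented_circle:
  assumes R: "R = ring_of_integers K" and P: "P \<in> bianchi_forms R"
  obtains C where "C \<in> oriented_Bianchi_circles K" "circle_form C = P"
proof -
  obtain C where C: "is_oriented_circle C" "circle_form C = P" using P by (rule bianchi_form_circle)
  have "underlying_circle C = {p. P (homogeneous p) = 0}"
    using underlying_circle_iff[OF C(1)] C(2) by auto
  then have "is_Bianchi_circle K (underlying_circle C)"
    using bianchi_form_zero_set[OF P] by (simp add: is_Bianchi_circle_def R)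
  then show thesis using that C by (simp add: oriented_Bianchi_circles_def)
qed

lemma immediately_tangent_adjacent_forms:
  assumes R: "R = ring_of_integers K" and tan: "immediately_tangent K C D"
  shows "adjacent_forms R (circle_form C) (circle_form D)"
proof -
  have CD: "C \<in> oriented_Bianchi_circles K" "D \<in> oriented_Bianchi_circles K"
    and ext: "externally_tangent C D"
    and str: "\<And>B. B \<in> oriented_Bianchi_circles K \<Longrightarrow> \<not> straddles {C, D} B"
    using tan by (auto simp: immediately_tangent_def)
  have oC: "is_oriented_circle C" and oD: "is_oriented_circle D"
    using CD by (simp_all add: oriented_Bianchi_circles_def)
  \<comment> \<open>Scaling multiplies all circle forms by the same positive factor, so one point of
    the sphere shows the signs that every form has at \<open>v\<close>.\<close>
  have point: "\<exists>p. \<forall>X. sgn (circle_form X (homogeneous p)) = sgn (circle_form X v)"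
    if nz: "circle_form B v \<noteq> 0" for B v
  proof -
    have "v \<noteq> 0" using nz circle_form_zero_vector by metis
    then obtain l p where "l \<noteq> 0" "v = scale l (homogeneous p)" by (rule homogeneous_coordinates)
    then show ?thesis by (auto simp: circle_form_scale sgn_mult)
  qed
  have "\<exists>v. circle_form C v \<noteq> - circle_form D v"
  proof (rule ccontr)
    assume "\<not> ?thesis"
    then have eq: "circle_form C v = - circle_form D v" for v by blast
    have "underlying_circle C = underlying_circle D"
      by (intro set_eqI) (simp add: underlying_circle_iff oC oD eq)
    then show False
      using ext underlying_circle_not_singleton[OF oC] by (simp add: externally_tangent_def)
  qed
  moreover obtain p where "p \<in> underlying_circle C" "p \<in> underlying_circle D"
    using ext by (auto simp: externally_tangent_def is_singleton_def)
  then have "\<exists>v. v \<noteq> 0 \<and> circle_form C v = 0 \<and> circle_form D v = 0"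
    using underlying_circle_iff oC oD homogeneous_nonzero by blast
  moreover have "\<not> (\<exists>v. circle_form C v < 0 \<and> circle_form D v < 0)"
  proof
    assume "\<exists>v. circle_form C v < 0 \<and> circle_form D v < 0"
    then obtain v where v: "circle_form C v < 0" "circle_form D v < 0" by blast
    obtain p where "\<And>X. sgn (circle_form X (homogeneous p)) = sgn (circle_form X v)"
      using point[of C v] v by auto
    then have "circle_form C (homogeneous p) < 0" "circle_form D (homogeneous p) < 0"
      using v by (metis sgn_less)+
    then show False
      using ext circle_interior_iff oC oD by (auto simp: externally_tangent_def)
  qed
  moreover have "\<not> (\<exists>B \<in> bianchi_forms R.
      (\<exists>v. (circle_form C v = 0 \<or> circle_form D v = 0) \<and> B v < 0) \<and>
      (\<exists>v. (circle_form C v = 0 \<or> circle_form D v = 0) \<and> B v > 0))"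
  proof
    assume "\<exists>B \<in> bianchi_forms R.
      (\<exists>v. (circle_form C v = 0 \<or> circle_form D v = 0) \<and> B v < 0) \<and>
      (\<exists>v. (circle_form C v = 0 \<or> circle_form D v = 0) \<and> B v > 0)"
    then obtain F v v' where F: "F \<in> bianchi_forms R"
      and v: "circle_form C v = 0 \<or> circle_form D v = 0" "F v < 0"
      and v': "circle_form C v' = 0 \<or> circle_form D v' = 0" "F v' > 0" by blast
    obtain B where B: "B \<in> oriented_Bianchi_circles K" "circle_form B = F"
      using bianchi_form_oriented_circle[OF R F] by blast
    have oB: "is_oriented_circle B" using B(1) by (simp add: oriented_Bianchi_circles_def)
    obtain p where p: "\<And>X. sgn (circle_form X (homogeneous p)) = sgn (circle_form X v)"
      using point[of B v] v(2) B(2) by auto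
    obtain p' where p': "\<And>X. sgn (circle_form X (homogeneous p')) = sgn (circle_form X v')"
      using point[of B v'] v'(2) B(2) by auto
    have "p \<in> circle_interior B" "p' \<in> circle_exterior B"
      using p[of B] p'[of B] v(2) v'(2) B(2)
      by (simp_all add: circle_interior_iff[OF oB] circle_exterior_iff[OF oB] sgn_if split: if_splits)
    moreover have "p \<in> underlying_circle C \<or> p \<in> underlying_circle D"
      "p' \<in> underlying_circle C \<or> p' \<in> underlying_circle D"
      using p[of C] p[of D] p'[of C] p'[of D] v(1) v'(1)
      by (auto simp: underlying_circle_iff[OF oC] underlying_circle_iff[OF oD] sgn_zero_iff)
    ultimately show False using str[OF B(1)] by (auto simp: straddles_def)
  qed
  ultimately show ?thesis
    unfolding adjacent_forms_def using oriented_bianchi_circle_form[OF R] CD by blast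
qed

end

section \<open>From closed walks to cyclic lists of circles\<close>

lemma pcas_successively:
  assumes "pcas u p v" "p \<noteq> []" "\<And>a b. (a, b) \<in> set p \<Longrightarrow> r a b"
  shows "successively r (u # map snd p) \<and> last (map snd p) = v"
  using assms
proof (induction p arbitrary: u)
  case (Cons e p)
  then show ?case by (cases p; cases e) auto
qed simp

lemma tl_pawalk_verts: "pcas u p v \<Longrightarrow> tl (pawalk_verts u p) = map snd p"
proof (induction p arbitrary: u)
  case (Cons e p)
  then show ?case by (cases p) auto
qed simp

theorem theorem5p1:
  fixes K :: "complex set" and \<Delta> :: int
  assumes "imaginary_quadratic_field K"
    and "has_discriminant K \<Delta>"
    and "\<Delta> \<le> -15"
  shows "\<not> has_undirected_cycle (immediate_tangency_graph K)"
proof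
  assume "has_undirected_cycle (immediate_tangency_graph K)"
  then obtain p u where p: "p \<noteq> []" "length p \<noteq> 2" "pcas u p u" "distinct (map snd p)"
    and arcs: "\<And>C D. (C, D) \<in> set p \<Longrightarrow> immediately_tangent K C D"
    unfolding has_undirected_cycle_def pre_digraph.cycle_def pre_digraph.awalk_def
      cas_with_proj_eq awalk_verts_with_proj_eq immediate_tangency_graph_def
    using tl_pawalk_verts by fastforce
  obtain \<omega> h where "quadratic_order (ring_of_integers K) \<omega> h"
    using quadratic_order_ring_of_integers[OF assms] by blast
  then interpret quadratic_order "ring_of_integers K" \<omega> h .
  define Cs where "Cs = map snd p"
  have succ: "successively (immediately_tangent K) (u # Cs)" and last: "last Cs = u"
    using pcas_successively[OF p(3,1) arcs] by (simp_all add: Cs_def)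
  have Cs: "Cs \<noteq> []" "length Cs \<noteq> 2" "distinct Cs" using p by (simp_all add: Cs_def)
  \<comment> \<open>The first arc leaves \<open>u\<close>, which is also the last entry of
    \<open>Cs\<close>.\<close>
  have closing: "immediately_tangent K (last Cs) (hd Cs)"
    using succ Cs(1) last by (simp add: successively_Cons)
  have oriented: "is_oriented_circle C" if "C \<in> set Cs" for C
    using that arcs by (auto simp: Cs_def immediately_tangent_def oriented_Bianchi_circles_def)
  \<comment> \<open>Directed cycles include loops at a vertex, which would be circles tangent to
    themselves.\<close>
  have "length Cs \<noteq> 1"
  proof
    assume "length Cs = 1"
    then obtain C where C: "Cs = [C]" by (auto simp: length_Suc_conv)
    then show False
      using closing underlying_circle_not_singleton[OF oriented[of C]]
      by (simp add: immediately_tangent_def externally_tangent_def)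
  qed
  with Cs have "3 \<le> length (map circle_form Cs)" by (cases Cs rule: remdups_adj.cases) (auto simp: Suc_le_eq)
  moreover have "distinct (map circle_form Cs)"
    using Cs(3) oriented circle_form_inj by (auto simp: distinct_map inj_on_def)
  moreover have "successively (immediately_tangent K) Cs"
    using succ Cs(1) by (simp add: successively_Cons)
  then have "successively (adjacent_forms (ring_of_integers K)) (map circle_form Cs)"
    unfolding successively_map
    by (rule successively_mono) (rule immediately_tangent_adjacent_forms[OF refl])
  moreover have "adjacent_forms (ring_of_integers K)
      (last (map circle_form Cs)) (hd (map circle_form Cs))"
    using immediately_tangent_adjacent_forms[OF refl closing] Cs(1) by (simp add: last_map hd_map)
  ultimately show False using no_cycle_of_forms by blast
qed

end
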